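(* The theory $ZFC^{-}_{count}$ cannot eliminate imaginaries.
   Context: $ZFC^{-}_{count}$ (countable set theory) is obtained from the axioms of $ZFC$, formulated with the Collection schema in place of Replacement, by removing the Powerset Axiom and adding the axiom $\forall x\ |x|\leq\omega$ (every set is countable). A theory $T$ eliminates imaginaries if whenever $T$ proves that some formula $E(x,y)$ defines an equivalence relation, there is a formula $F$ such that $T$ proves that $F$ defines a function and that for all $x,y$, $xEy$ iff $F(x)=F(y)$. *)

theory Defs
  imports Main
begin

datatype fm = Mem nat nat | Eq nat nat | Bot | Imp fm fm | All nat fm

definition Neg :: "fm \<Rightarrow> fm" where "Neg p = Imp p Bot"
definition Or :: "fm \<Rightarrow> fm \<Rightarrow> fm" where "Or p q = Imp (Neg p) q"
definition And :: "fm \<Rightarrow> fm \<Rightarrow> fm" where "And p q = Neg (Imp p (Neg q))"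
definition Iff :: "fm \<Rightarrow> fm \<Rightarrow> fm" where "Iff p q = And (Imp p q) (Imp q p)"
definition Ex :: "nat \<Rightarrow> fm \<Rightarrow> fm" where "Ex x p = Neg (All x (Neg p))"

fun FV :: "fm \<Rightarrow> nat set" where
  "FV (Mem a b) = {a, b}"
| "FV (Eq a b) = {a, b}"
| "FV Bot = {}"
| "FV (Imp p q) = FV p \<union> FV q"
| "FV (All x p) = FV p - {x}"

lemma finite_FV: "finite (FV p)"
  by (induction p) auto

fun substv :: "fm \<Rightarrow> nat \<Rightarrow> nat \<Rightarrow> fm" where
  "substv (Mem a b) x y = Mem (if a = x then y else a) (if b = x then y else b)"
| "substv (Eq a b) x y = Eq (if a = x then y else a) (if b = x then y else b)"
| "substv Bot x y = Bot"
| "substv (Imp p q) x y = Imp (substv p x y) (substv q x y)"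
| "substv (All z p) x y = (if z = x then All z p else All z (substv p x y))"

fun substitutable :: "nat \<Rightarrow> nat \<Rightarrow> fm \<Rightarrow> bool" where
  "substitutable y x (Mem a b) = True"
| "substitutable y x (Eq a b) = True"
| "substitutable y x Bot = True"
| "substitutable y x (Imp p q) = (substitutable y x p \<and> substitutable y x q)"
| "substitutable y x (All z p) = (x \<notin> FV (All z p) \<or> (z \<noteq> y \<and> substitutable y x p))"

definition close :: "fm \<Rightarrow> fm" where
  "close p = foldr All (sorted_list_of_set (FV p)) p"

inductive prov :: "fm set \<Rightarrow> fm \<Rightarrow> bool" where
  ax: "p \<in> T \<Longrightarrow> prov T p"
| A1: "prov T (Imp p (Imp q p))"
| A2: "prov T (Imp (Imp p (Imp q r)) (Imp (Imp p q) (Imp p r)))"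
| A3: "prov T (Imp (Imp (Imp p Bot) Bot) p)"
| Q1: "substitutable y x p \<Longrightarrow> prov T (Imp (All x p) (substv p x y))"
| Q2: "x \<notin> FV p \<Longrightarrow> prov T (Imp (All x (Imp p q)) (Imp p (All x q)))"
| E1: "prov T (Eq x x)"
| E2: "prov T (Imp (Eq x y) (Imp (Mem x z) (Mem y z)))"
| E3: "prov T (Imp (Eq x y) (Imp (Mem z x) (Mem z y)))"
| E4: "prov T (Imp (Eq x y) (Imp (Eq x z) (Eq y z)))"
| MP: "prov T (Imp p q) \<Longrightarrow> prov T p \<Longrightarrow> prov T q"
| Gen: "prov T p \<Longrightarrow> prov T (All x p)"

definition ax_ext :: fm where
  "ax_ext = All 0 (All 1 (Imp (All 2 (Iff (Mem 2 0) (Mem 2 1))) (Eq 0 1)))"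

definition ax_found :: fm where
  "ax_found = All 0 (Imp (Ex 1 (Mem 1 0))
      (Ex 1 (And (Mem 1 0) (All 2 (Imp (Mem 2 1) (Neg (Mem 2 0)))))))"

definition ax_pair :: fm where
  "ax_pair = All 0 (All 1 (Ex 2 (All 3 (Iff (Mem 3 2) (Or (Eq 3 0) (Eq 3 1))))))"

definition ax_union :: fm where
  "ax_union = All 0 (Ex 1 (All 2 (Iff (Mem 2 1) (Ex 3 (And (Mem 3 0) (Mem 2 3))))))"

text \<open>Auxiliary formula builders; the bound-variable names are explicit arguments
and must be chosen distinct from each other and from the free ones.\<close>
definition is_empty :: "nat \<Rightarrow> nat \<Rightarrow> fm" where
  "is_empty b w = All w (Neg (Mem w b))"

definition is_succ :: "nat \<Rightarrow> nat \<Rightarrow> nat \<Rightarrow> fm" where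
  "is_succ c b d = All d (Iff (Mem d c) (Or (Mem d b) (Eq d b)))"

definition is_inductive :: "nat \<Rightarrow> nat \<Rightarrow> nat \<Rightarrow> nat \<Rightarrow> fm" where
  "is_inductive a b c d =
     And (Ex b (And (Mem b a) (is_empty b d)))
         (All b (Imp (Mem b a) (Ex c (And (Mem c a) (is_succ c b d)))))"

definition ax_inf :: fm where
  "ax_inf = Ex 0 (is_inductive 0 1 2 3)"

definition is_omega :: "nat \<Rightarrow> nat \<Rightarrow> nat \<Rightarrow> nat \<Rightarrow> nat \<Rightarrow> nat \<Rightarrow> fm" where
  "is_omega w v u b c d =
     And (is_inductive w b c d)
         (All v (Imp (is_inductive v b c d) (All u (Imp (Mem u w) (Mem u v)))))"

definition is_pair :: "nat \<Rightarrow> nat \<Rightarrow> nat \<Rightarrow> nat \<Rightarrow> nat \<Rightarrow> fm" where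
  "is_pair p a n z t =
     All z (Iff (Mem z p) (Or (All t (Iff (Mem t z) (Eq t a)))
                              (All t (Iff (Mem t z) (Or (Eq t a) (Eq t n))))))"

text \<open>Every set is countable: for every x there is an injection f from x into omega
(f a set of pairs (a,n) with a in x, n in omega, total on x, functional and injective).\<close>
definition ax_count :: fm where
  "ax_count = All 0 (Ex 1 (Ex 2 (And (is_omega 1 9 10 11 12 13)
     (And (All 3 (Imp (Mem 3 2) (Ex 5 (Ex 7 (And (is_pair 3 5 7 9 10) (And (Mem 5 0) (Mem 7 1)))))))
     (And (All 5 (Imp (Mem 5 0) (Ex 3 (And (Mem 3 2) (Ex 7 (is_pair 3 5 7 9 10))))))
          (All 3 (All 4 (All 5 (All 6 (All 7 (All 8
             (Imp (And (Mem 3 2) (And (Mem 4 2) (And (is_pair 3 5 7 9 10) (is_pair 4 6 8 9 10))))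
                  (Iff (Eq 5 6) (Eq 7 8))))))))))))))"

definition ax_choice :: fm where
  "ax_choice = All 0 (Imp
     (And (All 1 (Imp (Mem 1 0) (Ex 2 (Mem 2 1))))
          (All 1 (Imp (Mem 1 0) (All 3 (Imp (Mem 3 0)
              (Imp (Neg (Eq 1 3)) (Neg (Ex 2 (And (Mem 2 1) (Mem 2 3))))))))))
     (Ex 4 (All 1 (Imp (Mem 1 0) (Ex 2 (And (And (Mem 2 1) (Mem 2 4))
        (All 5 (Imp (And (Mem 5 1) (Mem 5 4)) (Eq 5 2)))))))))"

definition separation_instances :: "fm set" where
  "separation_instances = {close (All a (Ex b (All c (Iff (Mem c b) (And (Mem c a) p)))))
      | p a b c. distinct [a, b, c] \<and> b \<notin> FV p}"

definition collection_instances :: "fm set" where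
  "collection_instances = {close (All a (Imp (All x (Imp (Mem x a) (Ex y p)))
        (Ex b (All x (Imp (Mem x a) (Ex y (And (Mem y b) p)))))))
      | p a b x y. distinct [a, b, x, y] \<and> b \<notin> FV p}"

definition ZFC_minus_count :: "fm set" where
  "ZFC_minus_count = {ax_ext, ax_found, ax_pair, ax_union, ax_inf, ax_choice, ax_count}
      \<union> separation_instances \<union> collection_instances"

text \<open>For a formula E whose free variables are among 0 (=x) and 1 (=y), and
variables u, v not in {0,1}, inst E u v expresses E(u,v) without substitution.\<close>
definition inst :: "fm \<Rightarrow> nat \<Rightarrow> nat \<Rightarrow> fm" where
  "inst E u v = Ex 0 (Ex 1 (And (Eq 0 u) (And (Eq 1 v) E)))"

definition proves_equiv_rel :: "fm set \<Rightarrow> fm \<Rightarrow> bool" where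
  "proves_equiv_rel T E \<longleftrightarrow>
     prov T (All 2 (inst E 2 2)) \<and>
     prov T (All 2 (All 3 (Imp (inst E 2 3) (inst E 3 2)))) \<and>
     prov T (All 2 (All 3 (All 4 (Imp (And (inst E 2 3) (inst E 3 4)) (inst E 2 4)))))"

text \<open>F(x,z) (free variables among 0 = argument and 1 = value) defines a function.\<close>
definition proves_function :: "fm set \<Rightarrow> fm \<Rightarrow> bool" where
  "proves_function T F \<longleftrightarrow>
     prov T (All 2 (Ex 3 (And (inst F 2 3) (All 4 (Imp (inst F 2 4) (Eq 4 3))))))"

definition proves_reduces :: "fm set \<Rightarrow> fm \<Rightarrow> fm \<Rightarrow> bool" where
  "proves_reduces T E F \<longleftrightarrow>
     prov T (All 2 (All 3 (Iff (inst E 2 3) (Ex 4 (And (inst F 2 4) (inst F 3 4))))))"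

definition eliminates_imaginaries :: "fm set \<Rightarrow> bool" where
  "eliminates_imaginaries T \<longleftrightarrow>
     (\<forall>E. FV E \<subseteq> {0, 1} \<longrightarrow> proves_equiv_rel T E \<longrightarrow>
        (\<exists>F. FV F \<subseteq> {0, 1} \<and> proves_function T F \<and> proves_reduces T E F))"

end

(*
  Work with Cohen forcing adding a generic sequence x : nat -> int over the true hereditarily
  countable sets. In the extension consider x^ = {H_k : k in nat}, where
  H_k = {(n, j). j <= x n + k}, and the equivalence relation "a and b generate the same
  downward closed class under inclusion". Since translations of x by a bounded d do not change
  the class of x^, any invariant F(x^) = tau must be fixed by all translations by 0-1 sequences.
  By a Baire category argument (turbulence: a generic 0-1 translation can be chosen to move a
  condition by a single unit step, and unit steps connect any two conditions) every element of
  the transitive closure of tau, hence tau itself, is decided by some condition p. An unbounded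
  translation that fixes p then preserves tau but changes the class of x^.
*)
theory Submission
  imports Defs "HOL-Library.Countable_Set_Type"
begin

section \<open>Baire category on the space of integer sequences\<close>

text \<open>No sequence is generic over all true hereditarily countable sets, so the extension
  exists only through conditions. Quantifiers range over uncountably many names, while comeager
  truth survives only countable conjunctions. Formulas whose quantifiers reduce to countably many
  names are therefore read pointwise; Separation, Collection and the unknown \<open>F\<close> need
  the forcing relation itself. The main obstacle is that invariance of tau does not fix its
  elements: a translation may permute the transitive closure of tau. But that closure is countable,
  so by category a single condition and a single name in the closure account for a set of 0-1
  translations that is dense in some cylinder. Two of these that agree up to length N except at one
  coordinate differ by a translation that fixes the element and acts on conditions of length N as a
  unit step; what it does beyond N is invisible to them. The terms are integers and not bits because
  translations must be able to be unbounded, while a 0-1 translation moves each \<open>H_k\<close>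
  only within its neighbours.\<close>

type_synonym cond = "int list"
type_synonym point = "nat \<Rightarrow> int"

definition ext :: "cond \<Rightarrow> cond \<Rightarrow> bool" (infix "\<sqsubseteq>" 50)
  where "q \<sqsubseteq> p \<longleftrightarrow> length p \<le> length q \<and> (\<forall>i<length p. q ! i = p ! i)"

definition meets :: "point \<Rightarrow> cond \<Rightarrow> bool"
  where "meets x p \<longleftrightarrow> (\<forall>i<length p. x i = p ! i)"

lemma ext_refl [simp]: "p \<sqsubseteq> p"
  by (simp add: ext_def)

lemma ext_trans: "r \<sqsubseteq> q \<Longrightarrow> q \<sqsubseteq> p \<Longrightarrow> r \<sqsubseteq> p"
  by (auto simp: ext_def)

lemma ext_Nil [simp]: "p \<sqsubseteq> []"
  by (simp add: ext_def)

lemma meets_Nil [simp]: "meets x []"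
  by (simp add: meets_def)

lemma meets_mono: "meets x q \<Longrightarrow> q \<sqsubseteq> p \<Longrightarrow> meets x p"
  by (auto simp: ext_def meets_def)

lemma meets_compat: "meets x p \<Longrightarrow> meets x q \<Longrightarrow> p \<sqsubseteq> q \<or> q \<sqsubseteq> p"
  by (cases "length p \<le> length q") (auto simp: ext_def meets_def)

lemma ext_lengthen: "\<exists>q. q \<sqsubseteq> p \<and> n \<le> length q"
  by (rule exI[of _ "p @ replicate n 0"]) (auto simp: ext_def nth_append)

definition dense :: "cond set \<Rightarrow> bool"
  where "dense D \<longleftrightarrow> (\<forall>q. \<exists>r\<in>D. r \<sqsubseteq> q)"

text \<open>Truth at comeagerly many points of the cylinder of \<^term>\<open>p\<close>; this replaces generic filters throughout.\<close>

definition gen :: "cond \<Rightarrow> (point \<Rightarrow> bool) \<Rightarrow> bool"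
  where "gen p X \<longleftrightarrow> (\<exists>D :: nat \<Rightarrow> cond set. (\<forall>n. dense (D n)) \<and>
    (\<forall>x. meets x p \<longrightarrow> (\<forall>n. \<exists>r\<in>D n. meets x r) \<longrightarrow> X x))"

text \<open>Frees the index set from \<open>nat\<close>, so that several families of dense sets can
  be merged without explicit coding.\<close>

lemma gen_countableI:
  fixes D :: "'i :: countable \<Rightarrow> cond set"
  assumes "\<And>i. dense (D i)"
    and X: "\<And>x. meets x p \<Longrightarrow> (\<And>i. \<exists>r\<in>D i. meets x r) \<Longrightarrow> X x"
  shows "gen p X"
  unfolding gen_def
proof (intro exI[of _ "\<lambda>n. D (from_nat n)"] conjI allI impI)
  fix x assume x: "meets x p" "\<forall>n. \<exists>r\<in>D (from_nat n). meets x r"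
  have "\<exists>r\<in>D i. meets x r" for i
    using x(2)[rule_format, of "to_nat i"] by simp
  then show "X x" using X x(1) by blast
qed (use assms in auto)

lemma gen_triv: "(\<And>x. meets x p \<Longrightarrow> X x) \<Longrightarrow> gen p X"
  unfolding gen_def by (rule exI[of _ "\<lambda>_. UNIV"]) (auto simp: dense_def intro: ext_refl)

lemma gen_mono: "gen p X \<Longrightarrow> q \<sqsubseteq> p \<Longrightarrow> gen q X"
  unfolding gen_def using meets_mono by blast

lemma gen_imp: "gen p X \<Longrightarrow> (\<And>x. meets x p \<Longrightarrow> X x \<Longrightarrow> Y x) \<Longrightarrow> gen p Y"
  unfolding gen_def by blast

lemma gen_all:
  fixes X :: "'i :: countable \<Rightarrow> point \<Rightarrow> bool"
  assumes "\<And>i. gen p (X i)"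
  shows "gen p (\<lambda>x. \<forall>i. X i x)"
proof -
  have "\<forall>i. \<exists>D :: nat \<Rightarrow> cond set. (\<forall>n. dense (D n)) \<and>
    (\<forall>x. meets x p \<longrightarrow> (\<forall>n. \<exists>r\<in>D n. meets x r) \<longrightarrow> X i x)"
    using assms unfolding gen_def by blast
  from choice[OF this] obtain D :: "'i \<Rightarrow> nat \<Rightarrow> cond set" where
    D: "\<And>i n. dense (D i n)" "\<And>i x. meets x p \<Longrightarrow> (\<forall>n. \<exists>r\<in>D i n. meets x r) \<Longrightarrow> X i x"
    by blast
  show ?thesis
  proof (rule gen_countableI[where D = "\<lambda>(i, n). D i n"])
    show "dense (case j of (i, n) \<Rightarrow> D i n)" for j
      using D(1) by (cases j) simp
    fix x assume "meets x p" and m: "\<And>j. \<exists>r\<in>(case j of (i, n) \<Rightarrow> D i n). meets x r"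
    then show "\<forall>i. X i x" using D(2) m[of "(i, n)" for i n] by simp
  qed
qed

lemma gen_conj: "gen p X \<Longrightarrow> gen p Y \<Longrightarrow> gen p (\<lambda>x. X x \<and> Y x)"
  using gen_all[of p "\<lambda>b. if b then X else Y"] by (simp add: all_bool_eq)

lemma gen_mp: "gen p X \<Longrightarrow> gen p (\<lambda>x. X x \<longrightarrow> Y x) \<Longrightarrow> gen p Y"
  by (rule gen_imp[OF gen_conj[of p X "\<lambda>x. X x \<longrightarrow> Y x"]]) simp_all

lemma gen_imp2: "gen p X \<Longrightarrow> gen p Y \<Longrightarrow> (\<And>x. meets x p \<Longrightarrow> X x \<Longrightarrow> Y x \<Longrightarrow> Z x) \<Longrightarrow> gen p Z"
  by (rule gen_imp[OF gen_conj[of p X Y]]) simp_all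

lemma gen_cong: "gen p (\<lambda>x. X x \<longleftrightarrow> Y x) \<Longrightarrow> gen p X \<longleftrightarrow> gen p Y"
  by (blast intro: gen_imp2)

text \<open>Being comeager is a local property. There are only countably many conditions, so the
  dense families belonging to all of them merge into one countable family; the additional dense set
  \<open>D0\<close> makes a point pass through a good condition.\<close>

lemma gen_dense:
  assumes dense_below: "\<And>q. q \<sqsubseteq> p \<Longrightarrow> \<exists>r. r \<sqsubseteq> q \<and> gen r X"
  shows "gen p X"
proof -
  have "\<forall>r. \<exists>D :: nat \<Rightarrow> cond set. (\<forall>n. dense (D n)) \<and>
    (gen r X \<longrightarrow> (\<forall>x. meets x r \<longrightarrow> (\<forall>n. \<exists>s\<in>D n. meets x s) \<longrightarrow> X x))"
    (is "\<forall>r. ?Q r")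
  proof
    fix r show "?Q r"
    proof (cases "gen r X")
      case True
      then show ?thesis unfolding gen_def by blast
    next
      case False
      then show ?thesis
        by (intro exI[of _ "\<lambda>_. UNIV"]) (auto simp: dense_def intro: ext_refl)
    qed
  qed
  from choice[OF this] obtain D :: "cond \<Rightarrow> nat \<Rightarrow> cond set" where
    D: "\<And>r n. dense (D r n)"
       "\<And>r x. gen r X \<Longrightarrow> meets x r \<Longrightarrow> (\<forall>n. \<exists>s\<in>D r n. meets x s) \<Longrightarrow> X x"
    by blast
  define D0 where "D0 = {r. gen r X \<or> \<not> (r \<sqsubseteq> p \<or> p \<sqsubseteq> r)}"
  have "dense D0"
    unfolding dense_def
  proof
    fix q
    consider "q \<sqsubseteq> p" | "p \<sqsubseteq> q" | "\<not> (q \<sqsubseteq> p \<or> p \<sqsubseteq> q)" by blast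
    then show "\<exists>r\<in>D0. r \<sqsubseteq> q"
    proof cases
      case 1 then show ?thesis using dense_below unfolding D0_def by blast
    next
      case 2 then show ?thesis using dense_below[of p] unfolding D0_def by (auto intro: ext_trans)
    next
      case 3 then show ?thesis unfolding D0_def by (auto intro: ext_refl)
    qed
  qed
  show ?thesis
  proof (rule gen_countableI[where D = "\<lambda>i. case i of None \<Rightarrow> D0 | Some (r, n) \<Rightarrow> D r n"])
    show "dense (case i of None \<Rightarrow> D0 | Some (r, n) \<Rightarrow> D r n)" for i
      using \<open>dense D0\<close> D(1) by (simp split: option.split prod.split)
    fix x assume p: "meets x p"
      and m: "\<And>i. \<exists>r\<in>(case i of None \<Rightarrow> D0 | Some (r, n) \<Rightarrow> D r n). meets x r"
    obtain r where "r \<in> D0" "meets x r" using m[of None] by auto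
    then have "gen r X" using p meets_compat unfolding D0_def by blast
    moreover have "\<exists>s\<in>D r n. meets x s" for n using m[of "Some (r, n)"] by auto
    ultimately show "X x" using D(2) \<open>meets x r\<close> by blast
  qed
qed

text \<open>The Baire category theorem: successive extensions enter one dense set after another and
  outgrow every length, so their union is a point.\<close>

lemma gen_ex_point: 
  assumes "gen p X" shows "\<exists>x. meets x p \<and> X x"
proof -
  obtain D :: "nat \<Rightarrow> cond set" where D: "\<And>n. dense (D n)"
    and X: "\<And>x. meets x p \<Longrightarrow> (\<forall>n. \<exists>r\<in>D n. meets x r) \<Longrightarrow> X x"
    using assms unfolding gen_def by blast
  have ex: "\<exists>r. r \<sqsubseteq> q \<and> r \<in> D n \<and> n < length r" for n q
  proof -
    have "\<exists>q'. q' \<sqsubseteq> q \<and> Suc n \<le> length q'" by (rule ext_lengthen)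
    then obtain q' where q': "q' \<sqsubseteq> q" "Suc n \<le> length q'" by blast
    then obtain r where "r \<in> D n" "r \<sqsubseteq> q'" using D[of n] unfolding dense_def by blast
    then show ?thesis using q' ext_trans by (intro exI[of _ r]) (auto simp: ext_def)
  qed
  define s where "s n q = (SOME r. r \<sqsubseteq> q \<and> r \<in> D n \<and> n < length r)" for n q
  have s: "s n q \<sqsubseteq> q \<and> s n q \<in> D n \<and> n < length (s n q)" for n q
    unfolding s_def by (rule someI_ex) (rule ex)
  define P where "P = rec_nat p s"
  have P: "P 0 = p" "\<And>n. P (Suc n) = s n (P n)" by (simp_all add: P_def)
  have mono: "m \<le> n \<Longrightarrow> P n \<sqsubseteq> P m" for m n
    by (induction n rule: dec_induct) (use s P in \<open>auto intro: ext_trans\<close>)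
  \<comment> \<open>Coordinate \<open>i\<close> is already settled at stage \<open>Suc i\<close>,
    since \<open>P (Suc i)\<close> is longer than \<open>i\<close>.\<close>
  define x where "x i = P (Suc i) ! i" for i
  have mx: "meets x (P n)" for n
    unfolding meets_def
  proof (intro allI impI)
    fix i assume i: "i < length (P n)"
    have "i < length (P (Suc i))" using s P by simp
    then show "x i = P n ! i"
      using mono[of "Suc i" n] mono[of n "Suc i"] i unfolding x_def
      by (cases "Suc i \<le> n") (auto simp: ext_def)
  qed
  have "\<exists>r\<in>D n. meets x r" for n
    using mx[of "Suc n"] s P by auto
  then show ?thesis using X mx[of 0] P by auto
qed

lemma not_gen_False: "\<not> gen p (\<lambda>x. False)"
  using gen_ex_point by blast

section \<open>The property of Baire\<close>

definition baire :: "(point \<Rightarrow> bool) \<Rightarrow> bool"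
  where "baire X \<longleftrightarrow> (\<forall>p. \<exists>q. q \<sqsubseteq> p \<and> (gen q X \<or> gen q (\<lambda>x. \<not> X x)))"

lemma baire_const [simp]: "baire (\<lambda>x. P)"
proof -
  have "gen p (\<lambda>x. P) \<or> gen p (\<lambda>x. \<not> P)" for p
    by (cases P) (simp_all add: gen_triv)
  then show ?thesis unfolding baire_def using ext_refl by blast
qed

lemma baire_not: "baire X \<Longrightarrow> baire (\<lambda>x. \<not> X x)"
  unfolding baire_def by auto

lemma not_genD: "baire X \<Longrightarrow> \<not> gen p X \<Longrightarrow> \<exists>q. q \<sqsubseteq> p \<and> gen q (\<lambda>x. \<not> X x)"
  unfolding baire_def using gen_dense[of p X] ext_trans by blast

lemma baire_ex:
  fixes X :: "'i :: countable \<Rightarrow> point \<Rightarrow> bool"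
  assumes "\<And>i. baire (X i)"
  shows "baire (\<lambda>x. \<exists>i. X i x)"
  unfolding baire_def
proof
  fix p
  show "\<exists>q. q \<sqsubseteq> p \<and> (gen q (\<lambda>x. \<exists>i. X i x) \<or> gen q (\<lambda>x. \<not> (\<exists>i. X i x)))"
  proof (cases "\<exists>q i. q \<sqsubseteq> p \<and> gen q (X i)")
    case True
    then obtain q i where q: "q \<sqsubseteq> p" "gen q (X i)" by blast
    have "gen q (\<lambda>x. \<exists>i. X i x)" by (rule gen_imp[OF q(2)]) blast
    then show ?thesis using q(1) by blast
  next
    case False
    then have "gen p (\<lambda>x. \<not> X i x)" for i
      using not_genD[OF baire_not[OF assms[of i]], of p] unfolding not_not by blast
    then have "gen p (\<lambda>x. \<forall>i. \<not> X i x)" by (rule gen_all)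
    then have "gen p (\<lambda>x. \<not> (\<exists>i. X i x))" by simp
    then show ?thesis using ext_refl by blast
  qed
qed

lemma baire_all:
  fixes X :: "'i :: countable \<Rightarrow> point \<Rightarrow> bool"
  assumes "\<And>i. baire (X i)"
  shows "baire (\<lambda>x. \<forall>i. X i x)"
  using baire_not[OF baire_ex[OF baire_not[OF assms]]] by simp

lemma baire_disj: "baire X \<Longrightarrow> baire Y \<Longrightarrow> baire (\<lambda>x. X x \<or> Y x)"
proof -
  assume XY: "baire X" "baire Y"
  have "baire (\<lambda>x. \<exists>b. (if b then X else Y) x)"
    by (rule baire_ex) (use XY in simp)
  then show ?thesis by (simp add: ex_bool_eq)
qed

lemma baire_conj: "baire X \<Longrightarrow> baire Y \<Longrightarrow> baire (\<lambda>x. X x \<and> Y x)"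
proof -
  assume XY: "baire X" "baire Y"
  have "baire (\<lambda>x. \<forall>b. (if b then X else Y) x)"
    by (rule baire_all) (use XY in simp)
  then show ?thesis by (simp add: all_bool_eq)
qed

lemma baire_imp: "baire X \<Longrightarrow> baire Y \<Longrightarrow> baire (\<lambda>x. X x \<longrightarrow> Y x)"
  using baire_disj[OF baire_not, of X Y] unfolding imp_conv_disj by blast

lemma baire_iff: "baire X \<Longrightarrow> baire Y \<Longrightarrow> baire (\<lambda>x. X x \<longleftrightarrow> Y x)"
  using baire_conj[OF baire_imp baire_imp, of X Y Y X] unfolding iff_conv_conj_imp by blast

lemmas baire_intros = baire_not baire_ex baire_all baire_disj baire_conj baire_imp baire_iff

text \<open>If no \<open>X i\<close> were comeager below any extension of \<open>p\<close>, the
  Baire property would make every complement comeager below \<open>p\<close>, and so also their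
  countable intersection.\<close>

lemma gen_exD:
  fixes X :: "'i :: countable \<Rightarrow> point \<Rightarrow> bool"
  assumes "\<And>i. baire (X i)" and "gen p (\<lambda>x. \<exists>i. X i x)"
  shows "\<exists>q i. q \<sqsubseteq> p \<and> gen q (X i)"
proof (rule ccontr)
  assume "\<not> ?thesis"
  then have "gen p (\<lambda>x. \<not> X i x)" for i
    using not_genD[OF baire_not[OF assms(1)[of i]], of p] unfolding not_not by blast
  then have "gen p (\<lambda>x. \<forall>i. \<not> X i x)" by (rule gen_all)
  from gen_ex_point[OF gen_conj[OF this assms(2)]] show False by blast
qed

section \<open>Open sets of points\<close>

definition opn :: "cond set \<Rightarrow> point \<Rightarrow> bool"
  where "opn S x \<longleftrightarrow> (\<exists>p\<in>S. meets x p)"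

lemma gen_opnD: "gen p (opn S) \<Longrightarrow> \<exists>q s. q \<sqsubseteq> p \<and> s \<in> S \<and> q \<sqsubseteq> s"
proof -
  assume "gen p (opn S)"
  then obtain x s where x: "meets x p" "s \<in> S" "meets x s"
    using gen_ex_point[of p "opn S"] unfolding opn_def by blast
  from meets_compat[OF x(1,3)] show ?thesis using x(2) ext_refl by blast
qed

lemma gen_opnI: "q \<sqsubseteq> s \<Longrightarrow> s \<in> S \<Longrightarrow> gen q (opn S)"
  by (rule gen_triv) (auto simp: opn_def intro: meets_mono)

lemma baire_opn [simp]: "baire (opn S)"
  unfolding baire_def
proof
  fix p
  show "\<exists>q. q \<sqsubseteq> p \<and> (gen q (opn S) \<or> gen q (\<lambda>x. \<not> opn S x))"
  proof (cases "\<exists>q s. q \<sqsubseteq> p \<and> s \<in> S \<and> q \<sqsubseteq> s")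
    case True
    then show ?thesis using gen_opnI by blast
  next
    case False
    have "\<not> opn S x" if "meets x p" for x
    proof
      assume "opn S x"
      then obtain s where "s \<in> S" "meets x s" unfolding opn_def by blast
      then show False using meets_compat[OF that] False ext_refl by blast
    qed
    then have "gen p (\<lambda>x. \<not> opn S x)" by (rule gen_triv)
    then show ?thesis using ext_refl by blast
  qed
qed

text \<open>A set with the Baire property is open up to a meager set, the open set being given by
  the conditions below which it is comeager. Since names carry only open data, this is how other
  properties of points enter a name.\<close>

lemma gen_opn_baire:
  assumes "baire X" shows "gen [] (\<lambda>x. opn {p. gen p X} x \<longleftrightarrow> X x)"
proof (rule gen_dense)
  fix q
  obtain r where r: "r \<sqsubseteq> q" "gen r X \<or> gen r (\<lambda>x. \<not> X x)" using assms unfolding baire_def by blast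
  have "gen r (\<lambda>x. opn {p. gen p X} x \<longleftrightarrow> X x)"
  proof (cases "gen r X")
    case True
    then show ?thesis by (rule gen_imp) (use True in \<open>auto simp: opn_def\<close>)
  next
    case False
    then have n: "gen r (\<lambda>x. \<not> X x)" using r by blast
    have "\<not> opn {p. gen p X} x" if x: "meets x r" for x
    proof
      assume "opn {p. gen p X} x"
      then obtain p where p: "gen p X" "meets x p" unfolding opn_def by blast
      then obtain s where "s \<sqsubseteq> p" "s \<sqsubseteq> r" using meets_compat x ext_refl by blast
      then have "gen s X" "gen s (\<lambda>x. \<not> X x)" using p n gen_mono by blast+
      from gen_ex_point[OF gen_conj[OF this]] show False by blast
    qed
    then show ?thesis by (intro gen_imp[OF n]) simp
  qed
  then show "\<exists>r. r \<sqsubseteq> q \<and> gen r (\<lambda>x. opn {p. gen p X} x \<longleftrightarrow> X x)" using r by blast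
qed

section \<open>Translations of conditions and points\<close>

definition shiftc :: "point \<Rightarrow> cond \<Rightarrow> cond"
  where "shiftc d p = map (\<lambda>i. p ! i + d i) [0..<length p]"

definition shift :: "point \<Rightarrow> point \<Rightarrow> point"
  where "shift d x = (\<lambda>i. x i + d i)"

lemma length_shiftc [simp]: "length (shiftc d p) = length p"
  by (simp add: shiftc_def)

lemma nth_shiftc [simp]: "i < length p \<Longrightarrow> shiftc d p ! i = p ! i + d i"
  by (simp add: shiftc_def)

lemma point_minus_minus [simp]: "- (- d) = (d :: point)"
  by (simp add: fun_eq_iff)

lemma shiftc_inverse [simp]:
  "shiftc (- d) (shiftc d p) = p" "shiftc d (shiftc (- d) p) = p"
  by (auto intro: nth_equalityI)

lemma shift_inverse [simp]: "shift (- d) (shift d x) = x" "shift d (shift (- d) x) = x"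
  by (auto simp: shift_def)

lemma ext_shiftc [simp]: "shiftc d q \<sqsubseteq> shiftc d p \<longleftrightarrow> q \<sqsubseteq> p"
  by (auto simp: ext_def)

lemma meets_shift: "meets (shift d x) (shiftc d p) \<longleftrightarrow> meets x p"
  by (simp add: meets_def shift_def)

lemma meets_shift': "meets (shift d x) p \<longleftrightarrow> meets x (shiftc (- d) p)"
  using meets_shift[of d x "shiftc (- d) p"] by simp

text \<open>A translation is an automorphism of the order of conditions and so carries dense sets to
  dense sets.\<close>

lemma gen_shift: "gen p (\<lambda>x. X (shift d x)) \<Longrightarrow> gen (shiftc d p) X"
proof -
  assume "gen p (\<lambda>x. X (shift d x))"
  then obtain D :: "nat \<Rightarrow> cond set" where D: "\<And>n. dense (D n)"
    and X: "\<And>x. meets x p \<Longrightarrow> (\<forall>n. \<exists>r\<in>D n. meets x r) \<Longrightarrow> X (shift d x)"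
    unfolding gen_def by blast
  show ?thesis
    unfolding gen_def
  proof (intro exI[of _ "\<lambda>n. shiftc d ` D n"] conjI allI impI)
    show "dense (shiftc d ` D n)" for n
      unfolding dense_def
    proof
      fix q
      obtain r where "r \<in> D n" "r \<sqsubseteq> shiftc (- d) q" using D[of n] unfolding dense_def by blast
      then have "shiftc d r \<sqsubseteq> shiftc d (shiftc (- d) q)" by (simp only: ext_shiftc)
      then have "shiftc d r \<sqsubseteq> q" by (simp only: shiftc_inverse)
      then show "\<exists>r\<in>shiftc d ` D n. r \<sqsubseteq> q" using \<open>r \<in> D n\<close> by auto
    qed
    fix x assume "meets x (shiftc d p)" "\<forall>n. \<exists>r\<in>shiftc d ` D n. meets x r"
    then show "X x"
      using X[of "shift (- d) x"] by (simp add: meets_shift')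
  qed
qed

lemma gen_shift_iff: "gen (shiftc d p) X \<longleftrightarrow> gen p (\<lambda>x. X (shift d x))"
  using gen_shift[of p X d] gen_shift[of "shiftc d p" "\<lambda>x. X (shift d x)" "- d"] by auto

section \<open>Hereditarily countable sets, names and forcing\<close>

datatype hc = HC "hc cset"

primrec elts :: "hc \<Rightarrow> hc set" where
  "elts (HC A) = rcset A"

definition mk :: "hc set \<Rightarrow> hc"
  where "mk A = HC (acset A)"

lemma elts_mk [simp]: "countable A \<Longrightarrow> elts (mk A) = A"
  by (simp add: mk_def)

lemma countable_elts [simp]: "countable (elts a)"
  by (cases a) simp

lemma mk_elts [simp]: "mk (elts a) = a"
  by (cases a) (simp add: mk_def rcset_inverse)

lemma hc_eqI: "(\<And>c. c \<in> elts a \<longleftrightarrow> c \<in> elts b) \<Longrightarrow> a = b"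
proof -
  assume "\<And>c. c \<in> elts a \<longleftrightarrow> c \<in> elts b"
  then have "mk (elts a) = mk (elts b)" by (intro arg_cong[of _ _ mk] set_eqI)
  then show "a = b" by simp
qed

lemma hc_induct [case_names mem]:
  assumes "\<And>a. (\<And>b. b \<in> elts a \<Longrightarrow> P b) \<Longrightarrow> P a"
  shows "P a"
proof (induction a)
  case (HC A)
  then show ?case using assms[of "HC A"] by simp
qed

text \<open>The \<^term>\<open>n\<close>-th candidate of a name is a member of its value at \<^term>\<open>x\<close> iff \<^term>\<open>x\<close> meets
one of the \<^term>\<open>n\<close>-th conditions. \<open>Emp\<close> is there because a datatype must be inhabited.\<close>

datatype nm = Emp | Nm "nat \<Rightarrow> nm" "nat \<Rightarrow> cond set"

primrec nms :: "nm \<Rightarrow> nat \<Rightarrow> nm" where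
  "nms Emp = (\<lambda>n. Emp)"
| "nms (Nm f S) = f"

primrec cds :: "nm \<Rightarrow> nat \<Rightarrow> cond set" where
  "cds Emp = (\<lambda>n. {})"
| "cds (Nm f S) = S"

primrec val :: "nm \<Rightarrow> point \<Rightarrow> hc" where
  "val Emp = (\<lambda>x. mk {})"
| "val (Nm f S) = (\<lambda>x. mk ((\<lambda>n. val (f n) x) ` {n. opn (S n) x}))"

lemma elts_val: "elts (val t x) = {val (nms t n) x |n. opn (cds t n) x}"
  by (cases t) (auto simp: opn_def)

lemma mem_val_iff: "a \<in> elts (val t x) \<longleftrightarrow> (\<exists>n. opn (cds t n) x \<and> a = val (nms t n) x)"
  by (auto simp: elts_val)

lemma val_eq_iff:
  "val s x = val t x \<longleftrightarrow>
    (\<forall>n. opn (cds s n) x \<longrightarrow> (\<exists>m. opn (cds t m) x \<and> val (nms s n) x = val (nms t m) x)) \<and>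
    (\<forall>m. opn (cds t m) x \<longrightarrow> (\<exists>n. opn (cds s n) x \<and> val (nms s n) x = val (nms t m) x))"
proof -
  have "val s x = val t x \<longleftrightarrow> elts (val s x) \<subseteq> elts (val t x) \<and> elts (val t x) \<subseteq> elts (val s x)"
    by (auto intro: hc_eqI)
  also have "elts (val s x) \<subseteq> elts (val t x) \<longleftrightarrow>
    (\<forall>n. opn (cds s n) x \<longrightarrow> (\<exists>m. opn (cds t m) x \<and> val (nms s n) x = val (nms t m) x))"
    unfolding elts_val by blast
  also have "elts (val t x) \<subseteq> elts (val s x) \<longleftrightarrow>
    (\<forall>m. opn (cds t m) x \<longrightarrow> (\<exists>n. opn (cds s n) x \<and> val (nms t m) x = val (nms s n) x))"
    unfolding elts_val by blast
  finally show ?thesis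
    unfolding eq_commute[of "val (nms t m) x" "val (nms s n) x" for m n] .
qed

text \<open>By \<open>val_eq_iff\<close>, equality is a countable Boolean combination of open sets
  and of equalities whose left side is a candidate of \<open>s\<close>. Hence induction on
  \<open>s\<close> alone suffices, with \<open>t\<close> arbitrary.\<close>

lemma baire_val_eq: "baire (\<lambda>x. val s x = val t x)"
proof (induction s arbitrary: t)
  case Emp
  have "(\<lambda>x. val Emp x = val t x) = (\<lambda>x. \<forall>m. \<not> opn (cds t m) x)"
    by (rule HOL.ext) (subst val_eq_iff, simp add: opn_def)
  then show ?case by (simp only:) (intro baire_all baire_not baire_opn)
next
  case (Nm f S)
  have "baire (\<lambda>x. (\<forall>n. opn (S n) x \<longrightarrow> (\<exists>m. opn (cds t m) x \<and> val (f n) x = val (nms t m) x)) \<and>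
     (\<forall>m. opn (cds t m) x \<longrightarrow> (\<exists>n. opn (S n) x \<and> val (f n) x = val (nms t m) x)))"
    by (intro baire_conj baire_all baire_imp baire_ex baire_opn Nm) simp_all
  moreover have "(\<lambda>x. val (Nm f S) x = val t x) =
    (\<lambda>x. (\<forall>n. opn (S n) x \<longrightarrow> (\<exists>m. opn (cds t m) x \<and> val (f n) x = val (nms t m) x)) \<and>
     (\<forall>m. opn (cds t m) x \<longrightarrow> (\<exists>n. opn (S n) x \<and> val (f n) x = val (nms t m) x)))"
    by (rule HOL.ext) (rule val_eq_iff[of "Nm f S", unfolded nms.simps cds.simps])
  ultimately show ?case by (simp only:)
qed

lemma baire_val_mem: "baire (\<lambda>x. val s x \<in> elts (val t x))"
  unfolding mem_val_iff by (intro baire_intros baire_opn baire_val_eq)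

abbreviation vale :: "(nat \<Rightarrow> nm) \<Rightarrow> point \<Rightarrow> nat \<Rightarrow> hc"
  where "vale e x \<equiv> (\<lambda>v. val (e v) x)"

text \<open>Atomic formulas are forced when they hold of the values at comeagerly many points, which avoids the
usual recursion over pairs of names.\<close>

primrec forces :: "fm \<Rightarrow> (nat \<Rightarrow> nm) \<Rightarrow> cond \<Rightarrow> bool" where
  "forces (Mem a b) e p = gen p (\<lambda>x. val (e a) x \<in> elts (val (e b) x))"
| "forces (Eq a b) e p = gen p (\<lambda>x. val (e a) x = val (e b) x)"
| "forces Bot e p = False"
| "forces (Imp \<phi> \<psi>) e p = (\<forall>q. q \<sqsubseteq> p \<longrightarrow> forces \<phi> e q \<longrightarrow> forces \<psi> e q)"
| "forces (All v \<phi>) e p = (\<forall>t. forces \<phi> (e(v := t)) p)"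

primrec sat :: "fm \<Rightarrow> (nat \<Rightarrow> hc) \<Rightarrow> bool" where
  "sat (Mem a b) h = (h a \<in> elts (h b))"
| "sat (Eq a b) h = (h a = h b)"
| "sat Bot h = False"
| "sat (Imp \<phi> \<psi>) h = (sat \<phi> h \<longrightarrow> sat \<psi> h)"
| "sat (All v \<phi>) h = (\<forall>a. sat \<phi> (h(v := a)))"

lemma sat_simps [simp]:
  "sat (Neg \<phi>) h \<longleftrightarrow> \<not> sat \<phi> h"
  "sat (And \<phi> \<psi>) h \<longleftrightarrow> sat \<phi> h \<and> sat \<psi> h"
  "sat (Or \<phi> \<psi>) h \<longleftrightarrow> sat \<phi> h \<or> sat \<psi> h"
  "sat (Iff \<phi> \<psi>) h \<longleftrightarrow> (sat \<phi> h \<longleftrightarrow> sat \<psi> h)"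
  "sat (Ex v \<phi>) h \<longleftrightarrow> (\<exists>a. sat \<phi> (h(v := a)))"
  by (auto simp: Neg_def And_def Or_def Iff_def Ex_def)

lemma forces_mono: "forces \<phi> e p \<Longrightarrow> q \<sqsubseteq> p \<Longrightarrow> forces \<phi> e q"
  by (induction \<phi> arbitrary: e p q) (auto intro: gen_mono ext_trans)

text \<open>Makes the logic classical although the clauses for \<open>Imp\<close> and
  \<open>All\<close> look intuitionistic: soundness of double negation elimination rests on it. The
  atomic cases are \<open>gen_dense\<close>.\<close>

lemma forces_dense:
  "(\<And>q. q \<sqsubseteq> p \<Longrightarrow> \<exists>r. r \<sqsubseteq> q \<and> forces \<phi> e r) \<Longrightarrow> forces \<phi> e p"
proof (induction \<phi> arbitrary: e p)
  case (Imp \<phi> \<psi>)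
  show ?case
    unfolding forces.simps
  proof (intro allI impI)
    fix q assume q: "q \<sqsubseteq> p" "forces \<phi> e q"
    show "forces \<psi> e q"
    proof (rule Imp.IH(2))
      fix r assume r: "r \<sqsubseteq> q"
      obtain s where s: "s \<sqsubseteq> r" "forces (Imp \<phi> \<psi>) e s" 
        using Imp.prems[OF ext_trans[OF r q(1)]] by blast
      have "forces \<phi> e s" using forces_mono[OF q(2)] s(1) r ext_trans by blast
      then have "forces \<psi> e s" using s(2) ext_refl unfolding forces.simps by blast
      then show "\<exists>r'. r' \<sqsubseteq> r \<and> forces \<psi> e r'" using s(1) by blast
    qed
  qed
next
  case (All v \<phi>)
  show ?case
    unfolding forces.simps
  proof
    fix t show "forces \<phi> (e(v := t)) p"
    proof (rule All.IH)
      fix q assume "q \<sqsubseteq> p"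
      then show "\<exists>r. r \<sqsubseteq> q \<and> forces \<phi> (e(v := t)) r"
        using All.prems[of q] unfolding forces.simps by blast
    qed
  qed
next
  case Bot
  from Bot[OF ext_refl] show ?case by simp
qed (auto intro: gen_dense)

text \<open>Allows an arbitrary name to be traded, below a suitable condition, for a candidate of
  another name, as Separation and Collection require.\<close>

lemma forces_cong:
  "(\<And>v. v \<in> FV \<phi> \<Longrightarrow> gen p (\<lambda>x. val (e v) x = val (e' v) x)) \<Longrightarrow> forces \<phi> e p \<longleftrightarrow> forces \<phi> e' p"
proof (induction \<phi> arbitrary: e e' p)
  case (Mem a b)
  have "gen p (\<lambda>x. val (e a) x = val (e' a) x \<and> val (e b) x = val (e' b) x)"
    by (rule gen_conj) (use Mem in auto)
  then show ?case unfolding forces.simps by (intro gen_cong) (auto elim: gen_imp)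
next
  case (Eq a b)
  have "gen p (\<lambda>x. val (e a) x = val (e' a) x \<and> val (e b) x = val (e' b) x)"
    by (rule gen_conj) (use Eq in auto)
  then show ?case unfolding forces.simps by (intro gen_cong) (auto elim: gen_imp)
next
  case (Imp \<phi> \<psi>)
  have "forces \<phi> e q \<longleftrightarrow> forces \<phi> e' q" if "q \<sqsubseteq> p" for q
    by (rule Imp.IH(1), rule gen_mono[OF Imp.prems that]) simp
  moreover have "forces \<psi> e q \<longleftrightarrow> forces \<psi> e' q" if "q \<sqsubseteq> p" for q
    by (rule Imp.IH(2), rule gen_mono[OF Imp.prems that]) simp
  ultimately show ?case by simp
next
  case (All v \<phi>)
  have "forces \<phi> (e(v := t)) p \<longleftrightarrow> forces \<phi> (e'(v := t)) p" for t
    by (rule All.IH) (auto intro: All.prems gen_triv)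
  then show ?case by simp
qed simp

lemma forces_agree: "(\<And>v. v \<in> FV \<phi> \<Longrightarrow> e v = e' v) \<Longrightarrow> forces \<phi> e p \<longleftrightarrow> forces \<phi> e' p"
  by (rule forces_cong) (simp add: gen_triv)

lemma forces_Neg: "forces (Neg \<phi>) e p \<longleftrightarrow> (\<forall>q. q \<sqsubseteq> p \<longrightarrow> \<not> forces \<phi> e q)"
  by (simp add: Neg_def)

lemma forces_And: "forces (And \<phi> \<psi>) e p \<longleftrightarrow> forces \<phi> e p \<and> forces \<psi> e p"
proof
  assume L: "forces (And \<phi> \<psi>) e p"
  have *: "\<exists>r. r \<sqsubseteq> q \<and> forces \<phi> e r \<and> forces \<psi> e r" if q: "q \<sqsubseteq> p" for q
  proof -
    obtain r s where "r \<sqsubseteq> q" "forces \<phi> e r" "s \<sqsubseteq> r" "forces \<psi> e s"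
      using L q unfolding And_def forces_Neg forces.simps by blast
    then show ?thesis using forces_mono ext_trans by blast
  qed
  show "forces \<phi> e p \<and> forces \<psi> e p"
    using * by (intro conjI forces_dense) blast+
next
  assume R: "forces \<phi> e p \<and> forces \<psi> e p"
  show "forces (And \<phi> \<psi>) e p"
    unfolding And_def forces_Neg forces.simps
    using R forces_mono ext_refl by blast
qed

lemma forces_Iff:
  "forces (Iff \<phi> \<psi>) e p \<longleftrightarrow> (\<forall>q. q \<sqsubseteq> p \<longrightarrow> (forces \<phi> e q \<longleftrightarrow> forces \<psi> e q))"
  unfolding Iff_def forces_And forces.simps by blast

lemma forces_Ex:
  "forces (Ex v \<phi>) e p \<longleftrightarrow> (\<forall>q. q \<sqsubseteq> p \<longrightarrow> (\<exists>r t. r \<sqsubseteq> q \<and> forces \<phi> (e(v := t)) r))"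
  unfolding Ex_def forces_Neg forces.simps by blast

lemma forces_ExI: "forces \<phi> (e(v := t)) p \<Longrightarrow> forces (Ex v \<phi>) e p"
  unfolding forces_Ex using forces_mono ext_refl by blast

section \<open>Soundness of forcing for the calculus\<close>

lemma substv_not_free: "x \<notin> FV \<phi> \<Longrightarrow> substv \<phi> x y = \<phi>"
  by (induction \<phi>) auto

lemma forces_substv:
  "substitutable y x \<phi> \<Longrightarrow> forces (substv \<phi> x y) e p \<longleftrightarrow> forces \<phi> (e(x := e y)) p"
proof (induction \<phi> arbitrary: e p)
  case (All z \<phi>)
  show ?case
  proof (cases "x \<in> FV (All z \<phi>)")
    case True
    then have z: "z \<noteq> x" "z \<noteq> y" "substitutable y x \<phi>" using All.prems by auto
    then have "forces (substv \<phi> x y) (e(z := t)) p \<longleftrightarrow> forces \<phi> ((e(x := e y))(z := t)) p" for t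
      using All.IH[OF z(3), of "e(z := t)" p] z(1,2) fun_upd_twist[of z x e t "e y"]
      by (simp only: fun_upd_other[OF z(2)[symmetric]])
    then show ?thesis using z(1) by (simp only: substv.simps forces.simps if_False)
  next
    case False
    then have "substv (All z \<phi>) x y = All z \<phi>" by (rule substv_not_free)
    then show ?thesis
      by (simp only:) (rule forces_agree, use False in auto)
  qed
qed auto

theorem forces_sound:
  assumes "prov T \<phi>" and "\<And>\<psi> e p. \<psi> \<in> T \<Longrightarrow> forces \<psi> e p"
  shows "forces \<phi> e p"
  using assms
proof (induction arbitrary: e p rule: prov.induct)
  case (ax \<phi> T)
  then show ?case by blast
next
  case (A1 T \<phi> \<psi>)
  show ?case unfolding forces.simps using forces_mono by blast
next
  case (A2 T \<phi> \<psi> \<chi>)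
  show ?case unfolding forces.simps
  proof (intro allI impI)
    fix q r s
    assume "\<forall>r. r \<sqsubseteq> q \<longrightarrow> forces \<phi> e r \<longrightarrow> (\<forall>s. s \<sqsubseteq> r \<longrightarrow> forces \<psi> e s \<longrightarrow> forces \<chi> e s)"
      and "r \<sqsubseteq> q" "\<forall>s. s \<sqsubseteq> r \<longrightarrow> forces \<phi> e s \<longrightarrow> forces \<psi> e s" "s \<sqsubseteq> r" "forces \<phi> e s"
    moreover have "s \<sqsubseteq> q" using ext_trans \<open>s \<sqsubseteq> r\<close> \<open>r \<sqsubseteq> q\<close> by blast
    ultimately show "forces \<chi> e s" using ext_refl[of s] by blast
  qed
next
  case (A3 T \<phi>)
  show ?case unfolding forces.simps
  proof (intro allI impI)
    fix q assume "\<forall>r. r \<sqsubseteq> q \<longrightarrow> (\<forall>s. s \<sqsubseteq> r \<longrightarrow> forces \<phi> e s \<longrightarrow> False) \<longrightarrow> False"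
    then show "forces \<phi> e q" by (intro forces_dense) blast
  qed
next
  case (Q1 y x \<phi> T)
  then show ?case unfolding forces.simps forces_substv[OF Q1.hyps] by blast
next
  case (Q2 v \<phi> T \<psi>)
  have "forces \<phi> (e(v := t)) q \<longleftrightarrow> forces \<phi> e q" for t q
    by (rule forces_agree) (use Q2 in auto)
  then show ?case unfolding forces.simps by blast
next
  case (E2 T a b c)
  show ?case unfolding forces.simps
  proof (intro allI impI)
    fix q r
    assume "gen q (\<lambda>x. val (e a) x = val (e b) x)" "r \<sqsubseteq> q"
    then have eq: "gen r (\<lambda>x. val (e a) x = val (e b) x)" by (rule gen_mono)
    assume "gen r (\<lambda>x. val (e a) x \<in> elts (val (e c) x))"
    with eq show "gen r (\<lambda>x. val (e b) x \<in> elts (val (e c) x))"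
      by (rule gen_imp2) simp
  qed
next
  case (E3 T a b c)
  show ?case unfolding forces.simps
  proof (intro allI impI)
    fix q r
    assume "gen q (\<lambda>x. val (e a) x = val (e b) x)" "r \<sqsubseteq> q"
    then have eq: "gen r (\<lambda>x. val (e a) x = val (e b) x)" by (rule gen_mono)
    assume "gen r (\<lambda>x. val (e c) x \<in> elts (val (e a) x))"
    with eq show "gen r (\<lambda>x. val (e c) x \<in> elts (val (e b) x))"
      by (rule gen_imp2) simp
  qed
next
  case (E4 T a b c)
  show ?case unfolding forces.simps
  proof (intro allI impI)
    fix q r
    assume "gen q (\<lambda>x. val (e a) x = val (e b) x)" "r \<sqsubseteq> q"
    then have eq: "gen r (\<lambda>x. val (e a) x = val (e b) x)" by (rule gen_mono)
    assume "gen r (\<lambda>x. val (e a) x = val (e c) x)"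
    with eq show "gen r (\<lambda>x. val (e b) x = val (e c) x)"
      by (rule gen_imp2) simp
  qed
next
  case (MP T \<phi> \<psi> e p)
  have "forces (Imp \<phi> \<psi>) e p" "forces \<phi> e p" by (rule MP.IH, rule MP.prems, assumption)+
  then show ?case unfolding forces.simps using ext_refl[of p] by blast
next
  case (Gen T \<phi> v)
  then show ?case unfolding forces.simps by blast
next
  case (E1 T a)
  show ?case unfolding forces.simps by (rule gen_triv) (rule refl)
qed

lemma forces_close:
  assumes "\<And>e. forces \<phi> e p"
  shows "forces (close \<phi>) e p"
proof -
  have "forces (foldr All vs \<phi>) e p" for vs
    by (induction vs arbitrary: e) (auto intro: assms)
  then show ?thesis by (simp add: close_def)
qed

text \<open>Formulas for which forcing coincides with truth in the hereditarily countable sets at comeagerly many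
points; they play the role of the absolute formulas.\<close>

definition pw :: "fm \<Rightarrow> bool" where
  "pw \<phi> \<longleftrightarrow> (\<forall>e. baire (\<lambda>x. sat \<phi> (vale e x))) \<and>
    (\<forall>e p. forces \<phi> e p \<longleftrightarrow> gen p (\<lambda>x. sat \<phi> (vale e x)))"

lemma pw_Mem [simp]: "pw (Mem a b)"
  by (simp add: pw_def baire_val_mem)

lemma pw_Eq [simp]: "pw (Eq a b)"
  by (simp add: pw_def baire_val_eq)

lemma pw_Bot [simp]: "pw Bot"
  by (simp add: pw_def not_gen_False)

text \<open>To turn a forced implication into pointwise truth one passes to a condition that decides
  \<open>\<phi>\<close> comeagerly. This is why \<open>pw\<close> includes the Baire
  property.\<close>

lemma pw_Imp [simp]: 
  assumes "pw \<phi>" "pw \<psi>" shows "pw (Imp \<phi> \<psi>)"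
  unfolding pw_def
proof (intro conjI allI)
  fix e
  show "baire (\<lambda>x. sat (Imp \<phi> \<psi>) (vale e x))"
    using assms unfolding pw_def sat.simps by (intro baire_imp) auto
  fix p
  show "forces (Imp \<phi> \<psi>) e p \<longleftrightarrow> gen p (\<lambda>x. sat (Imp \<phi> \<psi>) (vale e x))"
  proof
    assume L: "forces (Imp \<phi> \<psi>) e p"
    show "gen p (\<lambda>x. sat (Imp \<phi> \<psi>) (vale e x))"
    proof (rule gen_dense)
      fix q assume q: "q \<sqsubseteq> p"
      have "baire (\<lambda>x. sat \<phi> (vale e x))" using assms unfolding pw_def by blast
      then obtain r where r: "r \<sqsubseteq> q"
        "gen r (\<lambda>x. sat \<phi> (vale e x)) \<or> gen r (\<lambda>x. \<not> sat \<phi> (vale e x))"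
        unfolding baire_def by blast
      have "gen r (\<lambda>x. sat (Imp \<phi> \<psi>) (vale e x))"
        using r(2)
      proof
        assume "gen r (\<lambda>x. sat \<phi> (vale e x))"
        then have "forces \<phi> e r" using assms unfolding pw_def by blast
        then have "forces \<psi> e r" using L q r(1) ext_trans unfolding forces.simps by blast
        then have "gen r (\<lambda>x. sat \<psi> (vale e x))" using assms unfolding pw_def by blast
        then show ?thesis by (rule gen_imp) simp
      next
        assume "gen r (\<lambda>x. \<not> sat \<phi> (vale e x))"
        then show ?thesis by (rule gen_imp) simp
      qed
      then show "\<exists>r. r \<sqsubseteq> q \<and> gen r (\<lambda>x. sat (Imp \<phi> \<psi>) (vale e x))" using r(1) by blast
    qed
  next
    assume R: "gen p (\<lambda>x. sat (Imp \<phi> \<psi>) (vale e x))"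
    show "forces (Imp \<phi> \<psi>) e p"
      unfolding forces.simps
    proof (intro allI impI)
      fix q assume "q \<sqsubseteq> p" "forces \<phi> e q"
      then have "gen q (\<lambda>x. sat \<phi> (vale e x))" "gen q (\<lambda>x. sat \<phi> (vale e x) \<longrightarrow> sat \<psi> (vale e x))"
        using assms gen_mono[OF R] unfolding pw_def by auto
      then have "gen q (\<lambda>x. sat \<psi> (vale e x))" by (rule gen_mp)
      then show "forces \<psi> e q" using assms unfolding pw_def by blast
    qed
  qed
qed

lemma pw_conn [simp]:
  "pw \<phi> \<Longrightarrow> pw (Neg \<phi>)"
  "pw \<phi> \<Longrightarrow> pw \<psi> \<Longrightarrow> pw (And \<phi> \<psi>)"
  "pw \<phi> \<Longrightarrow> pw \<psi> \<Longrightarrow> pw (Or \<phi> \<psi>)"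
  "pw \<phi> \<Longrightarrow> pw \<psi> \<Longrightarrow> pw (Iff \<phi> \<psi>)"
  by (simp_all add: Neg_def And_def Or_def Iff_def)

lemma vale_upd: "vale (e(v := t)) x = (vale e x)(v := val t x)"
  by auto

text \<open>A quantifier over all names cannot be moved through \<open>gen\<close>. If every
  counterexample at a point yields one among the values of the names \<open>W e i\<close>, which are
  countably many and chosen independently of the point, the quantifier becomes a countable
  conjunction.\<close>

lemma pw_All_index:
  fixes W :: "(nat \<Rightarrow> nm) \<Rightarrow> 'i :: countable \<Rightarrow> nm"
  assumes \<phi>: "pw \<phi>"
    and W: "\<And>e x. (\<And>i. sat \<phi> ((vale e x)(v := val (W e i) x))) \<Longrightarrow> sat (All v \<phi>) (vale e x)"
  shows "pw (All v \<phi>)"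
proof -
  have eq: "sat (All v \<phi>) (vale e x) \<longleftrightarrow> (\<forall>i. sat \<phi> (vale (e(v := W e i)) x))" for e x
    using W[where e = e and x = x] unfolding vale_upd by auto
  show ?thesis
    unfolding pw_def
  proof (intro conjI allI)
    fix e
    show "baire (\<lambda>x. sat (All v \<phi>) (vale e x))"
      unfolding eq by (rule baire_all) (use \<phi> in \<open>simp add: pw_def\<close>)
    fix p
    show "forces (All v \<phi>) e p \<longleftrightarrow> gen p (\<lambda>x. sat (All v \<phi>) (vale e x))"
    proof
      assume "forces (All v \<phi>) e p"
      then have "forces \<phi> (e(v := W e i)) p" for i by simp
      then have "gen p (\<lambda>x. sat \<phi> (vale (e(v := W e i)) x))" for i
        using \<phi> unfolding pw_def by blast
      then show "gen p (\<lambda>x. sat (All v \<phi>) (vale e x))"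
        unfolding eq by (rule gen_all)
    next
      assume R: "gen p (\<lambda>x. sat (All v \<phi>) (vale e x))"
      have "gen p (\<lambda>x. sat \<phi> (vale (e(v := t)) x))" for t
        by (rule gen_imp[OF R]) (unfold vale_upd, simp)
      then have "forces \<phi> (e(v := t)) p" for t
        using \<phi> unfolding pw_def by blast
      then show "forces (All v \<phi>) e p" by simp
    qed
  qed
qed

lemma pw_All:
  assumes \<phi>: "pw \<phi>" and count: "\<And>e. countable (W e)"
    and W: "\<And>e x. (\<And>t. t \<in> W e \<Longrightarrow> sat \<phi> ((vale e x)(v := val t x))) \<Longrightarrow> sat (All v \<phi>) (vale e x)"
  shows "pw (All v \<phi>)"
proof (rule pw_All_index[OF \<phi>, where W = "\<lambda>e n::nat. from_nat_into (insert Emp (W e)) n"])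
  fix e x
  assume *: "\<And>n::nat. sat \<phi> ((vale e x)(v := val (from_nat_into (insert Emp (W e)) n) x))"
  have "sat \<phi> ((vale e x)(v := val t x))" if "t \<in> W e" for t
  proof -
    have "t \<in> insert Emp (W e)" using that by simp
    then obtain n where "t = from_nat_into (insert Emp (W e)) n"
      using from_nat_into_surj[of "insert Emp (W e)" t] count by auto
    then show ?thesis using *[of n] by simp
  qed
  then show "sat (All v \<phi>) (vale e x)" by (rule W)
qed

lemma pw_Ex:
  assumes "pw \<phi>" and count: "\<And>e. countable (W e)"
    and W: "\<And>e x a. sat \<phi> ((vale e x)(v := a)) \<Longrightarrow> \<exists>t\<in>W e. sat \<phi> ((vale e x)(v := val t x))"
  shows "pw (Ex v \<phi>)"
  unfolding Ex_def
proof (rule pw_conn(1)[OF pw_All[OF _ count]])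
  show "pw (Neg \<phi>)" using assms(1) by simp
  fix e x
  assume "\<And>t. t \<in> W e \<Longrightarrow> sat (Neg \<phi>) ((vale e x)(v := val t x))"
  then show "sat (All v (Neg \<phi>)) (vale e x)"
    using W[of e x] unfolding sat.simps sat_simps by blast
qed

text \<open>A bounded quantifier needs only the candidates of the bounding name.\<close>

lemma pw_All_mem:
  assumes "pw \<phi>" "b \<noteq> v" shows "pw (All v (Imp (Mem v b) \<phi>))"
  by (rule pw_All[where W = "\<lambda>e. range (nms (e b))"])
     (use assms in \<open>auto simp: mem_val_iff\<close>)

lemma pw_Ex_mem:
  assumes "pw \<phi>" "b \<noteq> v" shows "pw (Ex v (And (Mem v b) \<phi>))"
  by (rule pw_Ex[where W = "\<lambda>e. range (nms (e b))"])
     (use assms in \<open>auto simp: mem_val_iff\<close>)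

section \<open>The axioms of countable set theory are forced\<close>

definition hempty :: hc where "hempty = mk {}"
definition hsucc :: "hc \<Rightarrow> hc" where "hsucc a = mk (insert a (elts a))"
definition hpair :: "hc \<Rightarrow> hc \<Rightarrow> hc" where "hpair a b = mk {mk {a}, mk {a, b}}"

primrec num :: "nat \<Rightarrow> hc" where
  "num 0 = hempty"
| "num (Suc n) = hsucc (num n)"

definition homega :: hc where "homega = mk (range num)"

lemma elts_hempty [simp]: "elts hempty = {}"
  by (simp add: hempty_def)

lemma elts_hsucc [simp]: "elts (hsucc a) = insert a (elts a)"
  by (simp add: hsucc_def)

lemma elts_homega [simp]: "elts homega = range num"
  by (simp add: homega_def)

lemma elts_hpair [simp]: "elts (hpair a b) = {mk {a}, mk {a, b}}"
  by (simp add: hpair_def)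

lemma hc_eq_iff: "a = b \<longleftrightarrow> elts a = elts b"
  by (metis mk_elts)

lemma mk_eq_iff: "countable A \<Longrightarrow> countable B \<Longrightarrow> mk A = mk B \<longleftrightarrow> A = B"
  by (simp add: hc_eq_iff)

lemma hpair_eq_iff [simp]: "hpair a b = hpair c d \<longleftrightarrow> a = c \<and> b = d"
  by (auto simp: hc_eq_iff[of "hpair a b"] doubleton_eq_iff mk_eq_iff)

lemma not_mem_self: "a \<notin> elts a"
  by (induction a rule: hc_induct) blast

lemma elts_num: "elts (num n) = num ` {..<n}"
  by (induction n) (auto simp: lessThan_Suc)

lemma num_eq_iff [simp]: "num m = num n \<longleftrightarrow> m = n"
proof -
  have "num m \<noteq> num n" if "m < n" for m n
  proof
    assume "num m = num n"
    moreover have "num m \<in> elts (num n)" using that by (simp add: elts_num)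
    ultimately show False using not_mem_self by simp
  qed
  then show ?thesis by (metis nat_neq_iff)
qed

definition inductive_hc :: "hc \<Rightarrow> bool" where
  "inductive_hc A \<longleftrightarrow> hempty \<in> elts A \<and> (\<forall>b\<in>elts A. hsucc b \<in> elts A)"

lemma homega_least: "inductive_hc A \<Longrightarrow> elts homega \<subseteq> elts A"
proof -
  assume A: "inductive_hc A"
  have "num n \<in> elts A" for n
    using A by (induction n) (simp_all add: inductive_hc_def)
  then show ?thesis by auto
qed

lemma inductive_homega: "inductive_hc homega"
  unfolding inductive_hc_def by (auto intro: range_eqI[of _ _ 0] range_eqI[of _ _ "Suc n" for n])

lemma sat_is_empty: "w \<noteq> b \<Longrightarrow> sat (is_empty b w) h \<longleftrightarrow> h b = hempty"
  by (auto simp: is_empty_def hc_eq_iff[of _ hempty])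

lemma sat_is_succ: "d \<noteq> c \<Longrightarrow> d \<noteq> b \<Longrightarrow> sat (is_succ c b d) h \<longleftrightarrow> h c = hsucc (h b)"
  by (auto simp: is_succ_def hc_eq_iff[of _ "hsucc _"])

lemma sat_is_inductive:
  "distinct [a, b, c, d] \<Longrightarrow> sat (is_inductive a b c d) h \<longleftrightarrow> inductive_hc (h a)"
  by (auto simp: is_inductive_def inductive_hc_def sat_is_empty sat_is_succ)

lemma sat_is_omega:
  assumes "distinct [w, v, u, b, c, d]"
  shows "sat (is_omega w v u b c d) h \<longleftrightarrow> h w = homega"
proof -
  have "sat (is_omega w v u b c d) h \<longleftrightarrow>
    inductive_hc (h w) \<and> (\<forall>A. inductive_hc A \<longrightarrow> elts (h w) \<subseteq> elts A)"
    using assms by (auto simp: is_omega_def sat_is_inductive)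
  also have "\<dots> \<longleftrightarrow> h w = homega"
  proof
    assume "inductive_hc (h w) \<and> (\<forall>A. inductive_hc A \<longrightarrow> elts (h w) \<subseteq> elts A)"
    then have "elts (h w) = elts homega"
      using homega_least inductive_homega by (intro equalityI) blast+
    then show "h w = homega" by (simp only: hc_eq_iff)
  qed (use homega_least inductive_homega in \<open>simp only:, blast\<close>)
  finally show ?thesis .
qed

lemma sat_is_pair:
  assumes "distinct [p, a, n, z, t]"
  shows "sat (is_pair p a n z t) h \<longleftrightarrow> h p = hpair (h a) (h n)"
proof -
  have "sat (is_pair p a n z t) h \<longleftrightarrow>
    (\<forall>b. b \<in> elts (h p) \<longleftrightarrow> b = mk {h a} \<or> b = mk {h a, h n})"
    using assms by (simp add: is_pair_def hc_eq_iff[of _ "mk _"] set_eq_iff)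
  also have "\<dots> \<longleftrightarrow> h p = hpair (h a) (h n)"
    by (auto simp: hc_eq_iff[of _ "hpair _ _"])
  finally show ?thesis .
qed

section \<open>Construction of names\<close>

lemma opn_UNIV [simp]: "opn UNIV x"
  by (auto simp: opn_def intro!: exI[of _ "[]"])

lemma ex_check: "\<exists>t. \<forall>x. val t x = a"
proof (induction a rule: hc_induct)
  case (mem a)
  define c where "c b = (SOME t. \<forall>x. val t x = b)" for b
  have c: "val (c b) x = b" if "b \<in> elts a" for b x
    using someI_ex[OF mem[OF that]] unfolding c_def by blast
  show ?case
  proof (cases "elts a = {}")
    case True
    then have "val Emp x = a" for x by (simp add: hc_eq_iff)
    then show ?thesis by blast
  next
    case False
    have "val (Nm (\<lambda>n. c (from_nat_into (elts a) n)) (\<lambda>n. UNIV)) x = a" for x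
    proof -
      have "(\<lambda>n. val (c (from_nat_into (elts a) n)) x) ` UNIV = range (from_nat_into (elts a))"
        using c[OF from_nat_into[OF False]] by auto
      also have "\<dots> = elts a" by (rule range_from_nat_into[OF False countable_elts])
      finally show ?thesis by simp
    qed
    then show ?thesis by blast
  qed
qed

definition check :: "hc \<Rightarrow> nm" where
  "check a = (SOME t. \<forall>x. val t x = a)"

lemma val_check [simp]: "val (check a) x = a"
  using someI_ex[OF ex_check[of a]] unfolding check_def by blast

definition upair :: "nm \<Rightarrow> nm \<Rightarrow> nm" where
  "upair s t = Nm (\<lambda>n. if n = 0 then s else t) (\<lambda>n. UNIV)"

lemma val_upair [simp]: "val (upair s t) x = mk {val s x, val t x}"
proof -
  have "range (\<lambda>n::nat. val (if n = 0 then s else t) x) = {val s x, val t x}"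
    by (auto simp: image_iff intro: exI[of _ "0::nat"] exI[of _ "1::nat"])
  then show ?thesis by (simp add: upair_def)
qed

text \<open>A name for the set of all values of \<open>t i\<close> with \<open>X i\<close>. Each
  \<open>X i\<close> is represented by its open approximation, so the value is the intended one only
  at comeagerly many points, and only if each \<open>X i\<close> has the Baire property.\<close>

definition compr :: "('i :: countable \<Rightarrow> nm) \<Rightarrow> ('i \<Rightarrow> point \<Rightarrow> bool) \<Rightarrow> nm" where
  "compr t X = Nm (\<lambda>n. t (from_nat n)) (\<lambda>n. {p. gen p (X (from_nat n))})"

lemma gen_compr:
  assumes "\<And>i. baire (X i)"
  shows "gen p (\<lambda>x. elts (val (compr t X) x) = {val (t i) x |i. X i x})"
proof -
  have "gen [] (\<lambda>x. \<forall>n. opn {p. gen p (X (from_nat n))} x \<longleftrightarrow> X (from_nat n) x)"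
    by (intro gen_all gen_opn_baire assms)
  then have g: "gen p (\<lambda>x. \<forall>n. opn {p. gen p (X (from_nat n))} x \<longleftrightarrow> X (from_nat n) x)"
    by (rule gen_mono) simp
  show ?thesis
  proof (rule gen_imp[OF g])
    fix x assume *: "\<forall>n. opn {p. gen p (X (from_nat n))} x \<longleftrightarrow> X (from_nat n) x"
    have "elts (val (compr t X) x) = {val (t (from_nat n)) x |n. X (from_nat n) x}"
      using * by (auto simp: elts_val compr_def)
    also have "\<dots> = {val (t i) x |i. X i x}"
      by (metis from_nat_to_nat)
    finally show "elts (val (compr t X) x) = {val (t i) x |i. X i x}" .
  qed
qed

section \<open>Pointwise reading of the formulas in the axioms\<close>

lemma pw_is_empty [simp]: "w \<noteq> b \<Longrightarrow> pw (is_empty b w)"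
  unfolding is_empty_def Neg_def by (intro pw_All_mem) simp_all

text \<open>The unbounded biconditional can fail only at an element of \<open>c\<close>, at an
  element of \<open>b\<close>, or at \<open>b\<close> itself, and all of these have names in
  \<open>W\<close>.\<close>

lemma pw_is_succ [simp]:
  assumes "d \<noteq> c" "d \<noteq> b" shows "pw (is_succ c b d)"
  unfolding is_succ_def
  by (rule pw_All[where W = "\<lambda>e. insert (e b) (range (nms (e c)) \<union> range (nms (e b)))"])
     (use assms in \<open>auto simp: mem_val_iff ball_Un\<close>)

lemma pw_is_inductive [simp]: "distinct [a, b, c, d] \<Longrightarrow> pw (is_inductive a b c d)"
  unfolding is_inductive_def
  by (intro pw_conn pw_Ex_mem pw_All_mem pw_is_empty pw_is_succ) auto

text \<open>The quantifier over all inductive sets \<open>v\<close> is unbounded, but the single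
  instance \<open>homega\<close> settles it, being contained in every other one.\<close>

lemma pw_is_omega [simp]:
  assumes "distinct [w, v, u, b, c, d]" shows "pw (is_omega w v u b c d)"
  unfolding is_omega_def
proof (intro pw_conn)
  show "pw (is_inductive w b c d)" using assms by simp
  show "pw (All v (Imp (is_inductive v b c d) (All u (Imp (Mem u w) (Mem u v)))))"
  proof (rule pw_All[where W = "\<lambda>e. {check homega}"])
    show "pw (Imp (is_inductive v b c d) (All u (Imp (Mem u w) (Mem u v))))"
      using assms by (intro pw_Imp pw_is_inductive pw_All_mem) auto
    fix e x
    assume "\<And>t. t \<in> {check homega} \<Longrightarrow> sat (Imp (is_inductive v b c d) (All u (Imp (Mem u w) (Mem u v))))
      ((vale e x)(v := val t x))"
    then have "elts (val (e w) x) \<subseteq> elts homega"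
      using assms inductive_homega by (auto simp: sat_is_inductive)
    then have "elts (val (e w) x) \<subseteq> elts A" if "inductive_hc A" for A
      using homega_least[OF that] by blast
    then show "sat (All v (Imp (is_inductive v b c d) (All u (Imp (Mem u w) (Mem u v))))) (vale e x)"
      using assms by (auto simp: sat_is_inductive)
  qed simp
qed

lemma pw_sing: "t \<noteq> z \<Longrightarrow> t \<noteq> a \<Longrightarrow> pw (All t (Iff (Mem t z) (Eq t a)))"
  by (rule pw_All[where W = "\<lambda>e. insert (e a) (range (nms (e z)))"])
     (auto simp: mem_val_iff)

lemma pw_doub: "t \<noteq> z \<Longrightarrow> t \<noteq> a \<Longrightarrow> t \<noteq> b \<Longrightarrow> pw (All t (Iff (Mem t z) (Or (Eq t a) (Eq t b))))"
  by (rule pw_All[where W = "\<lambda>e. insert (e a) (insert (e b) (range (nms (e z))))"])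
     (auto simp: mem_val_iff)

text \<open>The biconditional can fail only at a member of \<open>p\<close> or at the singleton and
  the doubleton that ought to be members. The latter may not be candidates of \<open>p\<close>, so
  names for them are built with \<open>upair\<close>.\<close>

lemma pw_is_pair [simp]:
  assumes "distinct [p, a, n, z, t]" shows "pw (is_pair p a n z t)"
  unfolding is_pair_def
proof (rule pw_All[where W = "\<lambda>e. {upair (e a) (e a), upair (e a) (e n)} \<union> range (nms (e p))"])
  show "pw (Iff (Mem z p) (Or (All t (Iff (Mem t z) (Eq t a)))
                              (All t (Iff (Mem t z) (Or (Eq t a) (Eq t n))))))"
    using assms by (intro pw_conn pw_sing pw_doub) auto
  have sat_body: "sat (Iff (Mem z p) (Or (All t (Iff (Mem t z) (Eq t a)))
                              (All t (Iff (Mem t z) (Or (Eq t a) (Eq t n)))))) (h(z := b)) \<longleftrightarrow>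
     (b \<in> elts (h p) \<longleftrightarrow> b = mk {h a} \<or> b = mk {h a, h n})" for h b
    using assms by (simp add: hc_eq_iff[of _ "mk _"] set_eq_iff)
  show "countable ({upair (e a) (e a), upair (e a) (e n)} \<union> range (nms (e p)))" for e by simp
  fix e x
  assume *: "\<And>s. s \<in> {upair (e a) (e a), upair (e a) (e n)} \<union> range (nms (e p)) \<Longrightarrow>
    sat (Iff (Mem z p) (Or (All t (Iff (Mem t z) (Eq t a)))
                              (All t (Iff (Mem t z) (Or (Eq t a) (Eq t n))))))
     ((vale e x)(z := val s x))"
  show "sat (All z (Iff (Mem z p) (Or (All t (Iff (Mem t z) (Eq t a)))
                              (All t (Iff (Mem t z) (Or (Eq t a) (Eq t n))))))) (vale e x)"
    unfolding sat.simps(5) sat_body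
    using *[unfolded sat_body, of "upair (e a) (e a)"] *[unfolded sat_body, of "upair (e a) (e n)"]
      *[unfolded sat_body, of "nms (e p) k" for k]
    by (auto simp: mem_val_iff)
qed

lemma pw_forces: "pw \<phi> \<Longrightarrow> gen p (\<lambda>x. sat \<phi> (vale e x)) \<Longrightarrow> forces \<phi> e p"
  by (simp add: pw_def)

lemma pw_forces_triv: "pw \<phi> \<Longrightarrow> (\<And>x. sat \<phi> (vale e x)) \<Longrightarrow> forces \<phi> e p"
  by (rule pw_forces) (simp_all add: gen_triv)

section \<open>The single axioms\<close>

lemma forces_ax_ext: "forces ax_ext e p"
proof -
  have "pw (All 2 (Iff (Mem 2 0) (Mem 2 1)))"
    by (rule pw_All[where W = "\<lambda>e. range (nms (e 0)) \<union> range (nms (e 1))"])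
       (auto simp: mem_val_iff ball_Un)
  then have *: "pw (Imp (All 2 (Iff (Mem 2 0) (Mem 2 1))) (Eq 0 1))" by simp
  show ?thesis
    unfolding ax_ext_def forces.simps(5)
    by (intro allI pw_forces_triv[OF *]) (auto simp: hc_eq_iff)
qed

lemma hc_foundation: "c \<in> elts a \<Longrightarrow> \<exists>b\<in>elts a. \<forall>d\<in>elts b. d \<notin> elts a"
  by (induction c rule: hc_induct) blast

lemma forces_ax_found: "forces ax_found e p"
proof -
  have "pw (Ex 1 (Mem 1 0))"
    by (rule pw_Ex[where W = "\<lambda>e. range (nms (e 0))"]) (auto simp: mem_val_iff)
  then have *: "pw (Imp (Ex 1 (Mem 1 0))
      (Ex 1 (And (Mem 1 0) (All 2 (Imp (Mem 2 1) (Neg (Mem 2 0)))))))"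
    by (intro pw_Imp pw_Ex_mem pw_All_mem) auto
  show ?thesis
    unfolding ax_found_def forces.simps(5)
    by (intro allI pw_forces_triv[OF *]) (simp, use hc_foundation in blast)
qed

lemma forces_ax_pair: "forces ax_pair e p"
  unfolding ax_pair_def forces.simps(5)
proof (intro allI)
  fix s t
  let ?e = "e(0 := s, 1 := t)"
  show "forces (Ex 2 (All 3 (Iff (Mem 3 2) (Or (Eq 3 0) (Eq 3 1))))) ?e p"
    by (rule forces_ExI[where t = "upair s t"]) (auto intro!: pw_forces_triv)
qed

lemma forces_ax_union: "forces ax_union e p"
  unfolding ax_union_def forces.simps(5)
proof (intro allI)
  fix s
  define X where "X = (\<lambda>(n, m) x. opn (cds s n) x \<and> opn (cds (nms s n) m) x)"
  define u where "u = compr (\<lambda>(n, m). nms (nms s n) m) X"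
  have "gen p (\<lambda>x. elts (val u x) = {val (case i of (n, m) \<Rightarrow> nms (nms s n) m) x |i. X i x})"
    unfolding u_def by (rule gen_compr) (auto simp: X_def intro!: baire_conj)
  then have u: "gen p (\<lambda>x. elts (val u x) = (\<Union>c\<in>elts (val s x). elts c))"
  proof (rule gen_imp)
    fix x
    have "(\<Union>c\<in>elts (val s x). elts c) = (\<Union>n\<in>{n. opn (cds s n) x}. elts (val (nms s n) x))"
      unfolding elts_val[of s] by blast
    also have "\<dots> = {val (case i of (n, m) \<Rightarrow> nms (nms s n) m) x |i. X i x}"
      unfolding elts_val X_def by auto
    finally show "elts (val u x) = {val (case i of (n, m) \<Rightarrow> nms (nms s n) m) x |i. X i x} \<Longrightarrow>
      elts (val u x) = (\<Union>c\<in>elts (val s x). elts c)" by simp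
  qed
  have "forces (Iff (Mem 2 1) (Ex 3 (And (Mem 3 0) (Mem 2 3)))) (e(0 := s, 1 := u, 2 := t)) p" for t
    by (intro pw_forces pw_conn pw_Ex_mem pw_Mem gen_imp[OF u]) auto
  then show "forces (Ex 1 (All 2 (Iff (Mem 2 1) (Ex 3 (And (Mem 3 0) (Mem 2 3)))))) (e(0 := s)) p"
    by (intro forces_ExI[where t = u]) simp
qed

lemma forces_ax_inf: "forces ax_inf e p"
  unfolding ax_inf_def
  by (rule forces_ExI[where t = "check homega"])
     (auto intro!: pw_forces_triv simp: sat_is_inductive inductive_homega)

text \<open>The name \<open>s\<close> comes with an enumeration \<open>b\<close> of the candidates
  of its candidates. From each member of the family the choice set takes the element of least index
  in \<open>b\<close>; disjointness prevents a member from also receiving the element chosen for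
  another.\<close>

lemma forces_ax_choice: "forces ax_choice e p"
proof -
  define A where "A = And (All 1 (Imp (Mem 1 0) (Ex 2 (Mem 2 1))))
          (All 1 (Imp (Mem 1 0) (All 3 (Imp (Mem 3 0)
              (Imp (Neg (Eq 1 3)) (Neg (Ex 2 (And (Mem 2 1) (Mem 2 3)))))))))"
  define B where "B = All 1 (Imp (Mem 1 0) (Ex 2 (And (And (Mem 2 1) (Mem 2 4))
        (All 5 (Imp (And (Mem 5 1) (Mem 5 4)) (Eq 5 2))))))"
  have "pw (Ex 2 (Mem 2 1))"
    by (rule pw_Ex[where W = "\<lambda>e. range (nms (e 1))"]) (auto simp: mem_val_iff)
  then have pwA: "pw A"
    unfolding A_def by (intro pw_conn pw_Imp pw_Ex_mem pw_All_mem) auto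
  have "pw (All 5 (Imp (And (Mem 5 1) (Mem 5 4)) (Eq 5 2)))"
    by (rule pw_All[where W = "\<lambda>e. range (nms (e 1))"]) (auto simp: mem_val_iff)
  then have "pw (Ex 2 (And (And (Mem 2 1) (Mem 2 4))
        (All 5 (Imp (And (Mem 5 1) (Mem 5 4)) (Eq 5 2)))))"
    by (intro pw_Ex[where W = "\<lambda>e. range (nms (e 1))"]) (auto simp: mem_val_iff)
  then have pwB: "pw B"
    unfolding B_def by (intro pw_All_mem) auto
  have "forces (Ex 4 B) (e(0 := s)) q" if A: "forces A (e(0 := s)) q" for s q
  proof -
    define b where "b k = (case prod_decode k of (n, m) \<Rightarrow> nms (nms s n) m)" for k
    define X where "X k x \<longleftrightarrow> (\<exists>n. opn (cds s n) x \<and> val (b k) x \<in> elts (val (nms s n) x) \<and>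
      (\<forall>j. j < k \<longrightarrow> val (b j) x \<notin> elts (val (nms s n) x)))" for k x
    define c where "c = compr b X"
    have X: "X k x \<longleftrightarrow> (\<exists>y\<in>elts (val s x). val (b k) x \<in> elts y \<and> (\<forall>j<k. val (b j) x \<notin> elts y))" for k x
      unfolding X_def elts_val[of s] by blast
    have b: "\<exists>k. a = val (b k) x" if a: "a \<in> elts y" "y \<in> elts (val s x)" for a y x
    proof -
      obtain n m where "a = val (nms (nms s n) m) x" using a by (auto simp: mem_val_iff)
      then have "a = val (b (prod_encode (n, m))) x" by (simp add: b_def)
      then show ?thesis ..
    qed
    have gA: "gen q (\<lambda>x. sat A (vale (e(0 := s)) x))" using A pwA unfolding pw_def by blast
    have "baire (X k)" for k
      unfolding X_def by (intro baire_ex baire_conj baire_all baire_imp baire_not baire_opn baire_val_mem baire_const)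
    then have gc: "gen q (\<lambda>x. elts (val c x) = {val (b k) x |k. X k x})"
      unfolding c_def by (rule gen_compr)
    have "gen q (\<lambda>x. sat B (vale (e(0 := s, 4 := c)) x))"
    proof (rule gen_imp2[OF gA gc])
      fix x assume A: "sat A (vale (e(0 := s)) x)" and c: "elts (val c x) = {val (b k) x |k. X k x}"
      have "(\<forall>y. y \<in> elts (val s x) \<longrightarrow> (\<exists>a. a \<in> elts y)) \<and>
        (\<forall>y. y \<in> elts (val s x) \<longrightarrow> (\<forall>z. z \<in> elts (val s x) \<longrightarrow> y \<noteq> z \<longrightarrow>
          (\<forall>a. a \<in> elts y \<longrightarrow> a \<notin> elts z)))"
        using A[unfolded A_def, simplified] by blast
      then have ne: "\<And>y. y \<in> elts (val s x) \<Longrightarrow> \<exists>a. a \<in> elts y"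
        and disj: "\<And>y z a. y \<in> elts (val s x) \<Longrightarrow> z \<in> elts (val s x) \<Longrightarrow> a \<in> elts y \<Longrightarrow> a \<in> elts z \<Longrightarrow> y = z"
        by blast+
      have "\<exists>a. a \<in> elts y \<and> a \<in> elts (val c x) \<and> (\<forall>a'. a' \<in> elts y \<and> a' \<in> elts (val c x) \<longrightarrow> a' = a)"
        if y: "y \<in> elts (val s x)" for y
      proof -
        define k where "k = (LEAST k. val (b k) x \<in> elts y)"
        have "\<exists>k. val (b k) x \<in> elts y" using ne[OF y] b[OF _ y] by metis
        then have k: "val (b k) x \<in> elts y" unfolding k_def by (rule LeastI_ex)
        have least: "\<forall>j<k. val (b j) x \<notin> elts y" unfolding k_def using not_less_Least by blast
        have "X k x" unfolding X using y k least by blast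
        moreover have "j = k" if j: "X j x" "val (b j) x \<in> elts y" for j
        proof -
          obtain z where z: "z \<in> elts (val s x)" "val (b j) x \<in> elts z" "\<forall>i<j. val (b i) x \<notin> elts z"
            using j(1) unfolding X by blast
          have "z = y" using disj z y j(2) by blast
          then show ?thesis using z least k j(2) by (metis nat_neq_iff)
        qed
        ultimately show ?thesis unfolding c using k by blast
      qed
      then show "sat B (vale (e(0 := s, 4 := c)) x)" unfolding B_def by simp
    qed
    then show ?thesis
      by (intro forces_ExI[where t = c] pw_forces[OF pwB])
  qed
  then show ?thesis
    unfolding ax_choice_def A_def[symmetric] B_def[symmetric] forces.simps(4,5) by blast
qed

text \<open>An element of the value of \<open>s\<close> is sent to the least index of an active
  candidate that has it as value. This index depends on the point, hence the use of
  \<open>compr\<close>.\<close>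

lemma forces_ax_count: "forces ax_count e p"
proof -
  define P where "P = All 3 (Imp (Mem 3 2) (Ex 5 (Ex 7 (And (is_pair 3 5 7 9 10) (And (Mem 5 0) (Mem 7 1))))))"
  define Q where "Q = All 5 (Imp (Mem 5 0) (Ex 3 (And (Mem 3 2) (Ex 7 (is_pair 3 5 7 9 10)))))"
  define R where "R = Imp (And (Mem 3 2) (And (Mem 4 2) (And (is_pair 3 5 7 9 10) (is_pair 4 6 8 9 10))))
                  (Iff (Eq 5 6) (Eq 7 8))"
  have "pw (Ex 7 (And (is_pair 3 5 7 9 10) (And (Mem 5 0) (Mem 7 1))))"
    by (rule pw_Ex[where W = "\<lambda>e. range (nms (e 1))"]) (auto simp: mem_val_iff sat_is_pair)
  then have "pw (Ex 5 (Ex 7 (And (is_pair 3 5 7 9 10) (And (Mem 5 0) (Mem 7 1)))))"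
  proof (rule pw_Ex[where W = "\<lambda>e. range (nms (e 0))"])
    fix e x a
    assume a: "sat (Ex 7 (And (is_pair 3 5 7 9 10) (And (Mem 5 0) (Mem 7 1)))) ((vale e x)(5 := a))"
    then have "a \<in> elts (val (e 0) x)" by auto
    then obtain n where "a = val (nms (e 0) n) x" unfolding mem_val_iff by blast
    then show "\<exists>t\<in>range (nms (e 0)).
      sat (Ex 7 (And (is_pair 3 5 7 9 10) (And (Mem 5 0) (Mem 7 1)))) ((vale e x)(5 := val t x))"
      using a by blast
  qed simp
  then have pwP: "pw P"
    unfolding P_def by (intro pw_All_mem) auto
  have "pw (Ex 7 (is_pair 3 5 7 9 10))"
  \<comment> \<open>The second coordinate \<open>c\<close> belongs to \<open>{a, c}\<close>, which
    belongs to the pair, so it is the value of a candidate of a candidate.\<close>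
  proof (rule pw_Ex[where W = "\<lambda>e. \<Union>n. range (nms (nms (e 3) n))"])
    fix e x c
    assume "sat (is_pair 3 5 7 9 10) ((vale e x)(7 := c))"
    then have c: "val (e 3) x = hpair (val (e 5) x) c" by (simp add: sat_is_pair)
    then have "mk {val (e 5) x, c} \<in> elts (val (e 3) x)" by simp
    then obtain n where n: "val (nms (e 3) n) x = mk {val (e 5) x, c}" unfolding mem_val_iff by metis
    have "c \<in> elts (val (nms (e 3) n) x)" unfolding n by simp
    then obtain m where "c = val (nms (nms (e 3) n) m) x" unfolding mem_val_iff by blast
    then show "\<exists>t\<in>\<Union>n. range (nms (nms (e 3) n)). sat (is_pair 3 5 7 9 10) ((vale e x)(7 := val t x))"
      using c by (auto simp: sat_is_pair)
  qed simp_all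
  then have pwQ: "pw Q"
    unfolding Q_def by (intro pw_All_mem pw_Ex_mem) auto
  have pwR: "pw R" unfolding R_def by simp
  have "forces (Ex 1 (Ex 2 (And (is_omega 1 9 10 11 12 13) (And P (And Q
      (All 3 (All 4 (All 5 (All 6 (All 7 (All 8 R))))))))))) (e(0 := s)) p" for s
  proof -
    define X where "X k x \<longleftrightarrow> opn (cds s k) x \<and>
      (\<forall>j. j < k \<longrightarrow> opn (cds s j) x \<longrightarrow> val (nms s j) x \<noteq> val (nms s k) x)" for k x
    define pr where "pr k = upair (upair (nms s k) (nms s k)) (upair (nms s k) (check (num k)))" for k
    have pr: "val (pr k) x = hpair (val (nms s k) x) (num k)" for k x
      by (simp add: pr_def hpair_def)
    define f where "f = compr pr X"
    have "baire (X k)" for k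
      unfolding X_def by (intro baire_conj baire_all baire_imp baire_not baire_opn baire_val_eq baire_const)
    then have "gen p (\<lambda>x. elts (val f x) = {val (pr k) x |k. X k x})"
      unfolding f_def by (rule gen_compr)
    then have f: "gen p (\<lambda>x. elts (val f x) = {hpair (val (nms s k) x) (num k) |k. X k x})"
      unfolding pr .
    let ?e = "e(0 := s, 1 := check homega, 2 := f)"
    have "forces (is_omega 1 9 10 11 12 13) ?e p"
      by (intro pw_forces_triv) (simp_all add: sat_is_omega)
    moreover have "forces P ?e p"
    proof (intro pw_forces[OF pwP] gen_imp[OF f])
      fix x assume f: "elts (val f x) = {hpair (val (nms s k) x) (num k) |k. X k x}"
      show "sat P (vale ?e x)"
        unfolding P_def by (auto simp: sat_is_pair f X_def mem_val_iff)
    qed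
    moreover have "forces Q ?e p"
    proof (intro pw_forces[OF pwQ] gen_imp[OF f])
      fix x assume f: "elts (val f x) = {hpair (val (nms s k) x) (num k) |k. X k x}"
      have "\<exists>k. X k x \<and> a = val (nms s k) x" if a: "a \<in> elts (val s x)" for a
      proof -
        let ?P = "\<lambda>k. opn (cds s k) x \<and> a = val (nms s k) x"
        define k where "k = (LEAST k. ?P k)"
        have "\<exists>k. ?P k" using a by (simp add: mem_val_iff)
        then have "?P k" unfolding k_def by (rule LeastI_ex)
        moreover have "\<not> ?P j" if "j < k" for j using that unfolding k_def by (rule not_less_Least)
        ultimately show ?thesis unfolding X_def by metis
      qed
      then show "sat Q (vale ?e x)"
        unfolding Q_def by (simp add: sat_is_pair f) blast
    qed
    moreover have "forces R (?e(3 := t3, 4 := t4, 5 := t5, 6 := t6, 7 := t7, 8 := t8)) p" for t3 t4 t5 t6 t7 t8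
    proof (intro pw_forces[OF pwR] gen_imp[OF f])
      fix x assume f: "elts (val f x) = {hpair (val (nms s k) x) (num k) |k. X k x}"
      have inj: "j = k" if "X j x" "X k x" "val (nms s j) x = val (nms s k) x" for j k
        using that unfolding X_def by (metis nat_neq_iff)
      have "val t5 x = val t6 x \<longleftrightarrow> val t7 x = val t8 x"
        if h: "hpair (val t5 x) (val t7 x) \<in> elts (val f x)" "hpair (val t6 x) (val t8 x) \<in> elts (val f x)"
      proof -
        obtain j where j: "X j x" "val t5 x = val (nms s j) x" "val t7 x = num j"
          using h(1) unfolding f mem_Collect_eq hpair_eq_iff by blast
        obtain k where k: "X k x" "val t6 x = val (nms s k) x" "val t8 x = num k"
          using h(2) unfolding f mem_Collect_eq hpair_eq_iff by blast
        show ?thesis unfolding j(2,3) k(2,3) num_eq_iff using inj[OF j(1) k(1)] by blast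
      qed
      then show "sat R (vale (?e(3 := t3, 4 := t4, 5 := t5, 6 := t6, 7 := t7, 8 := t8)) x)"
        unfolding R_def by (simp add: sat_is_pair) metis
    qed
    ultimately show ?thesis
      by (intro forces_ExI[where t = "check homega"] forces_ExI[where t = f])
         (simp add: forces_And)
  qed
  then show ?thesis
    unfolding ax_count_def P_def[symmetric] Q_def[symmetric] R_def[symmetric] forces.simps(5) by blast
qed

section \<open>Separation and Collection\<close>

text \<open>Membership is a countable disjunction over the candidates, so by \<open>gen_exD\<close>
  one of them takes effect below a stronger condition; a further extension puts it inside one of the
  conditions of that candidate.\<close>

lemma forces_Mem_witness:
  assumes "forces (Mem a b) e p"
  shows "\<exists>q n. q \<sqsubseteq> p \<and> gen q (\<lambda>x. val (e a) x = val (nms (e b) n) x) \<and> (\<exists>s\<in>cds (e b) n. q \<sqsubseteq> s)"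
proof -
  have "gen p (\<lambda>x. \<exists>n. opn (cds (e b) n) x \<and> val (e a) x = val (nms (e b) n) x)"
    using assms by (simp add: mem_val_iff)
  moreover have "baire (\<lambda>x. opn (cds (e b) n) x \<and> val (e a) x = val (nms (e b) n) x)" for n
    by (intro baire_conj baire_opn baire_val_eq)
  ultimately obtain q n where q: "q \<sqsubseteq> p"
    "gen q (\<lambda>x. opn (cds (e b) n) x \<and> val (e a) x = val (nms (e b) n) x)"
    using gen_exD[of "\<lambda>n x. opn (cds (e b) n) x \<and> val (e a) x = val (nms (e b) n) x" p] by blast
  have "gen q (opn (cds (e b) n))" by (rule gen_imp[OF q(2)]) simp
  then obtain r s where r: "r \<sqsubseteq> q" "s \<in> cds (e b) n" "r \<sqsubseteq> s" using gen_opnD by blast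
  have "gen r (\<lambda>x. val (e a) x = val (nms (e b) n) x)"
    by (rule gen_imp[OF gen_mono[OF q(2) r(1)]]) simp
  then show ?thesis using r q ext_trans by blast
qed

lemma forces_separation:
  assumes "\<phi> \<in> separation_instances"
  shows "forces \<phi> e p"
proof -
  obtain \<psi> a b c where \<phi>: "\<phi> = close (All a (Ex b (All c (Iff (Mem c b) (And (Mem c a) \<psi>)))))"
    and d: "distinct [a, b, c]" "b \<notin> FV \<psi>"
    using assms unfolding separation_instances_def by blast
  have "forces (Ex b (All c (Iff (Mem c b) (And (Mem c a) \<psi>)))) (e(a := s)) p" for e s
  proof -
    let ?\<theta> = "And (Mem c a) \<psi>"
    \<comment> \<open>The usual separation name. Forcing \<open>?\<theta>\<close> takes the place of
      the original conditions of the \<open>n\<close>-th candidate; since \<open>?\<theta>\<close>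
      contains \<open>Mem c a\<close>, it also accounts for membership in \<open>s\<close>.\<close>
    define t where "t = Nm (nms s) (\<lambda>n. {p. forces ?\<theta> (e(a := s, c := nms s n)) p})"
    have nms_t: "nms t = nms s" by (simp add: t_def)
    have "forces (Iff (Mem c b) ?\<theta>) (e(a := s, b := t, c := u)) p" for u
      unfolding forces_Iff
    proof (intro allI impI iffI)
      let ?e = "e(a := s, b := t, c := u)"
      fix q assume "forces (Mem c b) ?e q"
      note q = this
      show "forces ?\<theta> ?e q"
      proof (rule forces_dense)
        fix q' assume "q' \<sqsubseteq> q"
        then have "forces (Mem c b) ?e q'" using q forces_mono by blast
        from forces_Mem_witness[OF this] obtain r n v where r: "r \<sqsubseteq> q'" "r \<sqsubseteq> v"
          "gen r (\<lambda>x. val (?e c) x = val (nms (?e b) n) x)" "v \<in> cds (?e b) n" by blast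
        from r(4) have "forces ?\<theta> (e(a := s, c := nms s n)) v" using d by (simp add: t_def)
        then have "forces ?\<theta> (e(a := s, c := nms s n)) r" using r(2) by (rule forces_mono)
        also have "forces ?\<theta> (e(a := s, c := nms s n)) r \<longleftrightarrow> forces ?\<theta> ?e r"
        proof (rule forces_cong)
          fix v assume "v \<in> FV ?\<theta>"
          then have "v \<noteq> b" using d by (auto simp: And_def Neg_def)
          then show "gen r (\<lambda>x. val ((e(a := s, c := nms s n)) v) x = val (?e v) x)"
            using r(3) d by (auto simp: t_def eq_commute intro: gen_triv)
        qed
        finally show "\<exists>r. r \<sqsubseteq> q' \<and> forces ?\<theta> ?e r" using r(1) by blast
      qed
    next
      let ?e = "e(a := s, b := t, c := u)"
      fix q assume q: "forces ?\<theta> ?e q"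
      show "forces (Mem c b) ?e q"
      proof (rule forces_dense)
        fix q' assume "q' \<sqsubseteq> q"
        then have q': "forces ?\<theta> ?e q'" using q forces_mono by blast
        then have "forces (Mem c a) ?e q'" unfolding forces_And by blast
        from forces_Mem_witness[OF this] obtain r n where r: "r \<sqsubseteq> q'"
          "gen r (\<lambda>x. val (?e c) x = val (nms (?e a) n) x)" by blast
        have "forces ?\<theta> ?e r" using q' r(1) by (rule forces_mono)
        also have "forces ?\<theta> ?e r \<longleftrightarrow> forces ?\<theta> (e(a := s, c := nms s n)) r"
        proof (rule forces_cong)
          fix v assume "v \<in> FV ?\<theta>"
          then have "v \<noteq> b" using d by (auto simp: And_def Neg_def)
          then show "gen r (\<lambda>x. val (?e v) x = val ((e(a := s, c := nms s n)) v) x)"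
            using r(2) d by (auto intro: gen_triv)
        qed
        finally have g: "gen r (opn (cds t n))" by (intro gen_opnI[of r r]) (simp_all add: t_def)
        have "gen r (\<lambda>x. val u x \<in> elts (val t x))"
          by (rule gen_imp2[OF g r(2)]) (use d in \<open>auto simp: mem_val_iff nms_t\<close>)
        then show "\<exists>r. r \<sqsubseteq> q' \<and> forces (Mem c b) ?e r" using r(1) d by auto
      qed
    qed
    then show ?thesis by (intro forces_ExI[where t = t]) simp
  qed
  then show ?thesis unfolding \<phi> by (intro forces_close) simp
qed

lemma forces_collection:
  assumes "\<phi> \<in> collection_instances"
  shows "forces \<phi> e p"
proof -
  obtain \<psi> a b c d where \<phi>: "\<phi> = close (All a (Imp (All c (Imp (Mem c a) (Ex d \<psi>)))
        (Ex b (All c (Imp (Mem c a) (Ex d (And (Mem d b) \<psi>)))))))"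
    and dist: "distinct [a, b, c, d]" "b \<notin> FV \<psi>"
    using assms unfolding collection_instances_def by blast
  have "forces (Ex b (All c (Imp (Mem c a) (Ex d (And (Mem d b) \<psi>))))) (e(a := s)) p"
    if hyp: "forces (All c (Imp (Mem c a) (Ex d \<psi>))) (e(a := s)) p" for e s p
  proof -
    \<comment> \<open>One witness for each pair of a candidate and a condition is enough, and these
      pairs are countably many, so the witnesses fit into a single name. For a pair without a
      witness \<open>SOME\<close> gives an arbitrary name, which is harmless because Collection asks
      only for a large enough set.\<close>
    define w where "w = (\<lambda>(n, r). SOME u. forces \<psi> (e(a := s, c := nms s n, d := u)) r)"
    define t where "t = Nm (\<lambda>k. w (from_nat k)) (\<lambda>k. UNIV)"
    have t: "val (w i) x \<in> elts (val t x)" for i x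
      unfolding mem_val_iff by (intro exI[of _ "to_nat i"]) (simp add: t_def)
    have "forces (Ex d (And (Mem d b) \<psi>)) (e(a := s, b := t, c := u)) q"
      if q: "q \<sqsubseteq> p" "forces (Mem c a) (e(a := s, b := t, c := u)) q" for u q
      unfolding forces_Ex
    proof (intro allI impI)
      let ?e = "e(a := s, b := t, c := u)"
      fix q' assume q': "q' \<sqsubseteq> q"
      have "forces (Mem c a) ?e q'" using q(2) q' by (rule forces_mono)
      from forces_Mem_witness[OF this] obtain r n where r: "r \<sqsubseteq> q'"
        "gen r (\<lambda>x. val (?e c) x = val (nms (?e a) n) x)" by blast
      have rp: "r \<sqsubseteq> p" using r(1) q' q(1) ext_trans by blast
      have "forces (Mem c a) (e(a := s, c := u)) r"
        using forces_mono[OF q(2), of r] r(1) q' ext_trans dist by auto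
      then have "forces (Ex d \<psi>) (e(a := s, c := u)) r"
        using hyp rp unfolding forces.simps by blast
      then obtain r' v where r': "r' \<sqsubseteq> r" "forces \<psi> (e(a := s, c := u, d := v)) r'"
        unfolding forces_Ex using ext_refl by blast
      have eq: "forces \<psi> (e(a := s, c := nms s n, d := v)) r' \<longleftrightarrow> forces \<psi> (e(a := s, b := x, c := u, d := v)) r'" for v x
      proof (rule forces_cong)
        fix z assume "z \<in> FV \<psi>"
        then have "z \<noteq> b" using dist by auto
        then show "gen r' (\<lambda>y. val ((e(a := s, c := nms s n, d := v)) z) y = val ((e(a := s, b := x, c := u, d := v)) z) y)"
          using gen_mono[OF r(2) r'(1)] dist by (auto simp: eq_commute intro: gen_triv)
      qed
      \<comment> \<open>The idle update at \<open>b\<close> brings the assignment into the form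
        treated by \<open>eq\<close>.\<close>
      have "e(a := s, b := e b, c := u, d := v) = e(a := s, c := u, d := v)"
        using dist by auto
      then have "forces \<psi> (e(a := s, b := e b, c := u, d := v)) r'"
        using r'(2) by (simp only:)
      then have "forces \<psi> (e(a := s, c := nms s n, d := v)) r'" by (rule eq[THEN iffD2])
      then have "forces \<psi> (e(a := s, c := nms s n, d := w (n, r'))) r'"
        unfolding w_def by (auto intro: someI)
      then have "forces \<psi> (?e(d := w (n, r'))) r'" by (rule eq[THEN iffD1])
      moreover have "forces (Mem d b) (?e(d := w (n, r'))) r'"
        using dist t by (auto intro: gen_triv)
      ultimately have "forces (And (Mem d b) \<psi>) (?e(d := w (n, r'))) r'"
        unfolding forces_And by blast
      then show "\<exists>r t. r \<sqsubseteq> q' \<and> forces (And (Mem d b) \<psi>) (?e(d := t)) r"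
        using r'(1) r(1) ext_trans by blast
    qed
    then show ?thesis by (intro forces_ExI[where t = t]) simp
  qed
  then show ?thesis unfolding \<phi> by (intro forces_close) simp
qed

theorem forces_ZFC_minus_count: "\<phi> \<in> ZFC_minus_count \<Longrightarrow> forces \<phi> e p"
  unfolding ZFC_minus_count_def
  using forces_ax_ext forces_ax_found forces_ax_pair forces_ax_union forces_ax_inf
    forces_ax_choice forces_ax_count forces_separation forces_collection by blast

section \<open>Derivations in the Hilbert calculus\<close>

text \<open>Provability of an equivalence relation is a syntactic claim and calls for actual
  derivations. Hypotheses are kept as nested implications, so that the deduction theorem holds by
  definition and generalization under hypotheses comes from \<open>Q2\<close>.\<close>

primrec der :: "fm set \<Rightarrow> fm list \<Rightarrow> fm \<Rightarrow> bool" where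
  "der T [] q = prov T q"
| "der T (p # G) q = der T G (Imp p q)"

lemma der_prov: "prov T q \<Longrightarrow> der T G q"
  by (induction G arbitrary: q) (auto intro: prov.MP prov.A1)

lemma der_mp: "der T G (Imp p q) \<Longrightarrow> der T G p \<Longrightarrow> der T G q"
proof (induction G arbitrary: p q)
  case Nil
  then show ?case by (auto intro: prov.MP)
next
  case (Cons g G)
  have "der T G (Imp (Imp g (Imp p q)) (Imp (Imp g p) (Imp g q)))"
    by (rule der_prov) (rule prov.A2)
  from Cons.IH[OF Cons.IH[OF this]] Cons.prems show ?case by simp
qed

lemma der_hyp: "q \<in> set G \<Longrightarrow> der T G q"
proof (induction G arbitrary: q)
  case (Cons g G)
  have "prov T (Imp q q)"
    by (rule prov.MP[OF prov.MP[OF prov.A2 prov.A1]]) (rule prov.A1[where q = q])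
  then have "der T G (Imp q q)" by (rule der_prov)
  moreover have "der T G (Imp g q)" if "q \<in> set G"
    by (rule der_mp[OF _ Cons.IH[OF that]]) (rule der_prov[OF prov.A1])
  ultimately show ?case using Cons.prems by auto
qed simp

lemma der_weaken: "der T G q \<Longrightarrow> set G \<subseteq> set G' \<Longrightarrow> der T G' q"
proof (induction G arbitrary: q)
  case Nil
  then show ?case by (simp add: der_prov)
next
  case (Cons g G)
  then have "der T G' (Imp g q)" by simp
  then show ?case by (rule der_mp) (rule der_hyp, use Cons.prems in simp)
qed

lemma der_raa: "der T (Neg p # G) Bot \<Longrightarrow> der T G p"
  using der_mp[OF der_prov[OF prov.A3]] by (simp add: Neg_def)

lemma der_AllI:
  "der T G p \<Longrightarrow> (\<And>g. g \<in> set G \<Longrightarrow> x \<notin> FV g) \<Longrightarrow> der T G (All x p)"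
proof (induction G arbitrary: p)
  case (Cons g G)
  then have "der T G (All x (Imp g p))" by simp
  moreover have "der T G (Imp (All x (Imp g p)) (Imp g (All x p)))"
    by (rule der_prov) (use Cons.prems in \<open>simp add: prov.Q2\<close>)
  ultimately show ?case using der_mp by auto
qed (auto intro: prov.Gen)

lemma der_AllE: "der T G (All x p) \<Longrightarrow> substitutable y x p \<Longrightarrow> der T G (substv p x y)"
  by (rule der_mp[OF der_prov[OF prov.Q1]])

lemma der_AndI: "der T G p \<Longrightarrow> der T G q \<Longrightarrow> der T G (And p q)"
proof -
  assume p: "der T G p" and q: "der T G q"
  let ?G = "Imp p (Neg q) # G"
  have "der T ?G (Imp p (Imp q Bot))" by (rule der_hyp) (simp add: Neg_def)
  moreover have "der T ?G p" by (rule der_weaken[OF p]) auto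
  moreover have "der T ?G q" by (rule der_weaken[OF q]) auto
  ultimately have "der T ?G Bot" using der_mp by blast
  then show ?thesis by (simp add: And_def Neg_def)
qed

lemma der_AndE1: "der T G (And p q) \<Longrightarrow> der T G p"
proof (rule der_raa)
  assume pq: "der T G (And p q)"
  have "der T (q # p # Neg p # G) Bot"
    by (rule der_mp[of _ _ p]; rule der_hyp) (simp_all add: Neg_def)
  then have "der T (Neg p # G) (Imp p (Neg q))" by (simp add: Neg_def)
  moreover have "der T (Neg p # G) (Imp (Imp p (Neg q)) Bot)"
    by (rule der_weaken[OF pq[unfolded And_def Neg_def[of "Imp _ _"]]]) auto
  ultimately show "der T (Neg p # G) Bot" by (rule der_mp[rotated])
qed

lemma der_AndE2: "der T G (And p q) \<Longrightarrow> der T G q"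
proof (rule der_raa)
  assume pq: "der T G (And p q)"
  have "der T (p # Neg q # G) (Neg q)" by (rule der_hyp) simp
  then have "der T (Neg q # G) (Imp p (Neg q))" by simp
  moreover have "der T (Neg q # G) (Imp (Imp p (Neg q)) Bot)"
    by (rule der_weaken[OF pq[unfolded And_def Neg_def[of "Imp _ _"]]]) auto
  ultimately show "der T (Neg q # G) Bot" by (rule der_mp[rotated])
qed

lemma der_IffI: "der T (p # G) q \<Longrightarrow> der T (q # G) p \<Longrightarrow> der T G (Iff p q)"
  unfolding Iff_def by (intro der_AndI) simp_all

lemma der_IffE1: "der T G (Iff p q) \<Longrightarrow> der T G p \<Longrightarrow> der T G q"
  unfolding Iff_def by (rule der_mp[OF der_AndE1])

lemma der_IffE2: "der T G (Iff p q) \<Longrightarrow> der T G q \<Longrightarrow> der T G p"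
  unfolding Iff_def by (rule der_mp[OF der_AndE2])

lemma der_ExI: "der T G (substv p x y) \<Longrightarrow> substitutable y x p \<Longrightarrow> der T G (Ex x p)"
proof -
  assume p: "der T G (substv p x y)" and s: "substitutable y x p"
  let ?G = "All x (Neg p) # G"
  have "der T ?G (substv (Neg p) x y)"
    by (rule der_AllE, rule der_hyp) (use s in \<open>simp_all add: Neg_def\<close>)
  then have "der T ?G (Imp (substv p x y) Bot)" by (simp add: Neg_def)
  moreover have "der T ?G (substv p x y)" by (rule der_weaken[OF p]) auto
  ultimately have "der T ?G Bot" by (rule der_mp)
  then show ?thesis by (simp add: Ex_def Neg_def)
qed

lemma der_ExE:
  assumes ex: "der T G (Ex x p)" and q: "der T (p # G) q"
    and fresh: "\<And>g. g \<in> set G \<Longrightarrow> x \<notin> FV g" "x \<notin> FV q"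
  shows "der T G q"
proof (rule der_raa)
  let ?G = "Neg q # G"
  have "der T (p # ?G) (Imp q Bot)" by (rule der_hyp) (simp add: Neg_def)
  moreover have "der T (p # ?G) q" by (rule der_weaken[OF q]) auto
  ultimately have "der T (p # ?G) Bot" by (rule der_mp)
  then have "der T ?G (Neg p)" by (simp add: Neg_def)
  then have "der T ?G (All x (Neg p))"
    by (rule der_AllI) (use fresh in \<open>auto simp: Neg_def\<close>)
  moreover have "der T ?G (Imp (All x (Neg p)) Bot)"
    by (rule der_weaken[OF ex[unfolded Ex_def Neg_def[of "All _ _"]]]) auto
  ultimately show "der T ?G Bot" by (rule der_mp[rotated])
qed

text \<open>The bound variables avoid 2, 3 and 4, which are quantified in \<^const>\<open>proves_equiv_rel\<close>.\<close>

definition below :: "nat \<Rightarrow> fm" where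
  "below x = Ex 6 (And (Mem 6 x) (All 7 (Imp (Mem 7 5) (Mem 7 6))))"

text \<open>Mutual cofinality under inclusion: each member of one set is contained in a member of
  the other. Stated as equality of downward closures it is a universally quantified
  \<open>Iff\<close>, whose reflexivity, symmetry and transitivity are propositional and need no
  set-theoretic axiom.\<close>

definition cofin :: "nat \<Rightarrow> nat \<Rightarrow> fm" where
  "cofin x y = All 5 (Iff (below x) (below y))"

lemmas fm_defs = below_def cofin_def Ex_def And_def Neg_def Iff_def

lemma FV_below [simp]: "x \<notin> {6, 7} \<Longrightarrow> FV (below x) = {5, x}"
  by (auto simp: fm_defs)

lemma FV_cofin [simp]: "x \<notin> {5, 6, 7} \<Longrightarrow> y \<notin> {5, 6, 7} \<Longrightarrow> FV (cofin x y) = {x, y}"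
  by (auto simp: fm_defs)

text \<open>The calculus has equality axioms for atomic formulas only, so replacement of equals
  inside \<open>below\<close> is derived by hand.\<close>

lemma der_Eq_below:
  assumes "x \<notin> {5, 6, 7}" "y \<notin> {5, 6, 7}"
    and eq: "der T G (Eq x y)" and px: "der T G (below x)"
  shows "der T G (below y)"
proof -
  let ?s = "All 7 (Imp (Mem 7 5) (Mem 7 6))"
  let ?H = "[And (Mem 6 x) ?s, below x, Eq x y]"
  have ex: "der T [below x, Eq x y] (Ex 6 (And (Mem 6 x) ?s))"
    by (rule der_hyp) (simp add: below_def)
  have h: "der T ?H (And (Mem 6 x) ?s)" by (rule der_hyp) simp
  have "der T ?H (Eq x y)" by (rule der_hyp) simp
  then have "der T ?H (Imp (Mem 6 x) (Mem 6 y))" by (rule der_mp[OF der_prov[OF prov.E3]])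
  then have "der T ?H (Mem 6 y)" by (rule der_mp) (rule der_AndE1[OF h])
  from der_AndI[OF this der_AndE2[OF h]]
  \<comment> \<open>The witness for the bound variable 6 is 6 itself.\<close>
  have "der T ?H (substv (And (Mem 6 y) ?s) 6 6)" by (simp add: fm_defs)
  then have "der T ?H (below y)"
    unfolding below_def by (rule der_ExI) (simp add: fm_defs)
  then have "der T [below x, Eq x y] (below y)"
    by (rule der_ExE[OF ex]) (use assms(1,2) in auto)
  then have "der T G (Imp (Eq x y) (Imp (below x) (below y)))" by (simp add: der_prov)
  from der_mp[OF der_mp[OF this eq] px] show ?thesis .
qed

lemma der_Eq_sym: "der T G (Eq x y) \<Longrightarrow> der T G (Eq y x)"
  by (rule der_mp[OF der_mp[OF der_prov[OF prov.E4]]]) (auto intro: der_prov prov.E1)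

lemma der_cofinI:
  "der T G (Iff (below x) (below y)) \<Longrightarrow> (\<And>g. g \<in> set G \<Longrightarrow> 5 \<notin> FV g) \<Longrightarrow> der T G (cofin x y)"
  unfolding cofin_def by (rule der_AllI)

lemma der_cofinD: "der T G (cofin x y) \<Longrightarrow> der T G (Iff (below x) (below y))"
  using der_AllE[of T G 5 "Iff (below x) (below y)" 5] by (simp add: fm_defs)

abbreviation cofin01 :: fm where "cofin01 \<equiv> cofin 0 1"

lemma FV_inst:
  "x \<notin> {0, 1, 5, 6, 7} \<Longrightarrow> y \<notin> {0, 1, 5, 6, 7} \<Longrightarrow> FV (inst (cofin 0 (Suc 0)) x y) = {x, y}"
  by (auto simp: inst_def fm_defs)

lemma der_instI:
  assumes x: "x \<notin> {0, 1, 5, 6, 7}" and y: "y \<notin> {0, 1, 5, 6, 7}"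
    and c: "der T G (cofin x y)"
  shows "der T G (inst cofin01 x y)"
proof -
  have "der T G (And (Eq x x) (And (Eq y y) (cofin x y)))"
    by (intro der_AndI c der_prov prov.E1)
  then have "der T G (substv (And (Eq x x) (And (Eq 1 y) (cofin x 1))) 1 y)"
    using x y by (simp add: fm_defs)
  then have "der T G (Ex 1 (And (Eq x x) (And (Eq 1 y) (cofin x 1))))"
    by (rule der_ExI) (use x y in \<open>simp add: fm_defs\<close>)
  then have "der T G (substv (Ex 1 (And (Eq 0 x) (And (Eq 1 y) cofin01))) 0 x)"
    using x y by (simp add: fm_defs)
  then show ?thesis
    unfolding inst_def by (rule der_ExI) (use x y in \<open>simp add: fm_defs\<close>)
qed

lemma der_instD:
  assumes x: "x \<notin> {0, 1, 5, 6, 7}" and y: "y \<notin> {0, 1, 5, 6, 7}"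
    and i: "der T G (inst cofin01 x y)"
  shows "der T G (cofin x y)"
proof -
  let ?m = "And (Eq 0 x) (And (Eq 1 y) cofin01)"
  \<comment> \<open>The argument runs under three known hypotheses, so that the freshness conditions
    on 0, 1 and 5 can be checked; \<open>G\<close> is arbitrary and returns only at the end.\<close>
  let ?H = "[?m, Ex 1 ?m, inst cofin01 x y]"
  have FVm: "FV ?m = {0, 1, x, y}" "FV (Ex 1 ?m) = {0, x, y}"
    using x y by (auto simp: And_def Ex_def Neg_def)
  have ex1: "der T [Ex 1 ?m, inst cofin01 x y] (Ex 1 ?m)" by (rule der_hyp) simp
  have ex0: "der T [inst cofin01 x y] (Ex 0 (Ex 1 ?m))"
    by (rule der_hyp) (simp add: inst_def)
  have m: "der T ?H ?m" by (rule der_hyp) simp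
  have ex: "der T ?H (Eq 0 x)" by (rule der_AndE1[OF m])
  have ey: "der T ?H (Eq 1 y)" by (rule der_AndE1[OF der_AndE2[OF m]])
  have b: "der T ?H (Iff (below 0) (below 1))"
    by (rule der_cofinD[OF der_AndE2[OF der_AndE2[OF m]]])
  have w: "der T (p # ?H) q" if "der T ?H q" for p q
    by (rule der_weaken[OF that]) auto
  have fx: "x \<notin> {5, 6, 7}" "y \<notin> {5, 6, 7}" "0 \<notin> {5, 6, 7 :: nat}" "1 \<notin> {5, 6, 7 :: nat}"
    using x y by auto
  have h: "der T (p # ?H) p" for p by (rule der_hyp) simp
  have "der T ?H (Iff (below x) (below y))"
  proof (rule der_IffI)
    have "der T (below x # ?H) (below 0)"
      by (rule der_Eq_below[OF fx(1) fx(3) der_Eq_sym[OF w[OF ex]] h])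
    then have "der T (below x # ?H) (below 1)" by (rule der_IffE1[OF w[OF b]])
    then show "der T (below x # ?H) (below y)" by (rule der_Eq_below[OF fx(4) fx(2) w[OF ey]])
    have "der T (below y # ?H) (below 1)"
      by (rule der_Eq_below[OF fx(2) fx(4) der_Eq_sym[OF w[OF ey]] h])
    then have "der T (below y # ?H) (below 0)" by (rule der_IffE2[OF w[OF b]])
    then show "der T (below y # ?H) (below x)" by (rule der_Eq_below[OF fx(3) fx(1) w[OF ex]])
  qed
  then have "der T ?H (cofin x y)"
    by (rule der_cofinI) (use x y FVm in \<open>auto simp: FV_inst\<close>)
  then have "der T [Ex 1 ?m, inst cofin01 x y] (cofin x y)"
    by (rule der_ExE[OF ex1]) (use x y FVm in \<open>auto simp: FV_inst\<close>)
  then have "der T [inst cofin01 x y] (cofin x y)"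
    by (rule der_ExE[OF ex0]) (use x y in \<open>auto simp: FV_inst\<close>)
  then have "der T G (Imp (inst cofin01 x y) (cofin x y))" by (simp add: der_prov)
  from der_mp[OF this i] show ?thesis .
qed

theorem proves_equiv_rel_cofin: "proves_equiv_rel T cofin01"
  unfolding proves_equiv_rel_def
proof (intro conjI)
  have "der T [] (Iff (below 2) (below 2))" by (intro der_IffI der_hyp) simp_all
  then have "der T [] (inst cofin01 2 2)" by (intro der_instI der_cofinI) simp_all
  then show "prov T (All 2 (inst cofin01 2 2))" by (auto intro: prov.Gen)
next
  let ?G = "[inst cofin01 2 3]"
  have "der T ?G (inst cofin01 2 3)" by (rule der_hyp) simp
  then have b: "der T ?G (Iff (below 2) (below 3))" by (intro der_cofinD der_instD) simp_all
  have "der T ?G (Iff (below 3) (below 2))"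
    by (rule der_IffI; rule der_IffE1[OF der_weaken[OF b]] der_IffE2[OF der_weaken[OF b]])
       ((rule der_hyp subsetI, simp)+)
  then have "der T ?G (inst cofin01 3 2)"
    by (intro der_instI der_cofinI) (simp_all add: FV_inst)
  then show "prov T (All 2 (All 3 (Imp (inst cofin01 2 3) (inst cofin01 3 2))))"
    by (auto intro: prov.Gen)
next
  let ?G = "[And (inst cofin01 2 3) (inst cofin01 3 4)]"
  have a: "der T ?G (And (inst cofin01 2 3) (inst cofin01 3 4))" by (rule der_hyp) simp
  have b: "der T ?G (Iff (below 2) (below 3))"
    by (rule der_cofinD[OF der_instD[OF _ _ der_AndE1[OF a]]]) simp_all
  have c: "der T ?G (Iff (below 3) (below 4))"
    by (rule der_cofinD[OF der_instD[OF _ _ der_AndE2[OF a]]]) simp_all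
  have "der T ?G (Iff (below 2) (below 4))"
  proof (rule der_IffI)
    show "der T (below 2 # ?G) (below 4)"
      by (rule der_IffE1[OF der_weaken[OF c]], force, rule der_IffE1[OF der_weaken[OF b]])
         ((rule der_hyp subsetI, simp)+)
    show "der T (below 4 # ?G) (below 2)"
      by (rule der_IffE2[OF der_weaken[OF b]], force, rule der_IffE2[OF der_weaken[OF c]])
         ((rule der_hyp subsetI, simp)+)
  qed
  then have "der T ?G (inst cofin01 2 4)"
    by (intro der_instI der_cofinI) (simp_all add: And_def Neg_def FV_inst)
  then show "prov T (All 2 (All 3 (All 4 (Imp (And (inst cofin01 2 3) (inst cofin01 3 4))
      (inst cofin01 2 4)))))"
    by (auto intro: prov.Gen)
qed

section \<open>Homogeneity and the main theorem\<close>

definition samedown :: "hc \<Rightarrow> hc \<Rightarrow> bool" where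
  "samedown a b \<longleftrightarrow> (\<forall>z. (\<exists>w\<in>elts a. elts z \<subseteq> elts w) \<longleftrightarrow> (\<exists>w\<in>elts b. elts z \<subseteq> elts w))"

lemma sat_below: "x \<notin> {5, 6, 7} \<Longrightarrow> sat (below x) h \<longleftrightarrow> (\<exists>w\<in>elts (h x). elts (h 5) \<subseteq> elts w)"
  by (auto simp: below_def)

lemma sat_cofin:
  "x \<notin> {5, 6, 7} \<Longrightarrow> y \<notin> {5, 6, 7} \<Longrightarrow> sat (cofin x y) h \<longleftrightarrow> samedown (h x) (h y)"
  unfolding cofin_def sat.simps sat_simps by (simp add: sat_below samedown_def)

lemma pw_below: "x \<noteq> 6 \<Longrightarrow> pw (below x)"
  unfolding below_def by (intro pw_Ex_mem pw_All_mem pw_Mem) auto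

text \<open>Two downward closures agree as soon as they agree on the members of both sets, so the
  quantifier over all \<open>z\<close> reduces to the candidates of the two names.\<close>

lemma pw_cofin:
  assumes x: "x \<notin> {5, 6, 7}" and y: "y \<notin> {5, 6, 7}"
  shows "pw (cofin x y)"
  unfolding cofin_def
proof (rule pw_All[where W = "\<lambda>e. range (nms (e x)) \<union> range (nms (e y))"])
  show "pw (Iff (below x) (below y))" using x y by (intro pw_conn pw_below) auto
  fix e v
  have s: "sat (Iff (below x) (below y)) ((vale e v)(5 := z)) \<longleftrightarrow>
    ((\<exists>w\<in>elts (val (e x) v). elts z \<subseteq> elts w) \<longleftrightarrow> (\<exists>w\<in>elts (val (e y) v). elts z \<subseteq> elts w))" for z
    using x y by (simp add: sat_below)
  assume *: "\<And>t. t \<in> range (nms (e x)) \<union> range (nms (e y)) \<Longrightarrow>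
    sat (Iff (below x) (below y)) ((vale e v)(5 := val t v))"
  have h: "(\<exists>w\<in>elts (val (e x) v). elts z \<subseteq> elts w) \<longleftrightarrow> (\<exists>w\<in>elts (val (e y) v). elts z \<subseteq> elts w)"
    if z: "z \<in> elts (val (e x) v) \<union> elts (val (e y) v)" for z
  proof -
    obtain n where "z = val (nms (e x) n) v \<or> z = val (nms (e y) n) v"
      using z by (auto simp: mem_val_iff)
    then show ?thesis
      using *[of "nms (e x) n"] *[of "nms (e y) n"] unfolding s by auto
  qed
  have down: "\<exists>w'\<in>elts (val (e y) v). elts w \<subseteq> elts w'" if "w \<in> elts (val (e x) v)" for w
    using h[of w] that by blast
  have down': "\<exists>w'\<in>elts (val (e x) v). elts w \<subseteq> elts w'" if "w \<in> elts (val (e y) v)" for w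
    using h[of w] that by blast
  show "sat (All 5 (Iff (below x) (below y))) (vale e v)"
    unfolding sat.simps(5) s by (meson down down' subset_trans)
qed simp

lemma forces_inst:
  assumes u: "u \<notin> {0, 1}" and v: "v \<notin> {0, 1}"
  shows "forces (inst \<phi> u v) e p \<longleftrightarrow> forces \<phi> (e(0 := e u, 1 := e v)) p"
proof
  assume L: "forces (inst \<phi> u v) e p"
  show "forces \<phi> (e(0 := e u, 1 := e v)) p"
  proof (rule forces_dense)
    fix q assume "q \<sqsubseteq> p"
    then obtain r s where r: "r \<sqsubseteq> q" "forces (Ex 1 (And (Eq 0 u) (And (Eq 1 v) \<phi>))) (e(0 := s)) r"
      using L unfolding inst_def forces_Ex[of 0] by blast
    then obtain r' t where r': "r' \<sqsubseteq> r" "forces (And (Eq 0 u) (And (Eq 1 v) \<phi>)) (e(0 := s, 1 := t)) r'"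
      unfolding forces_Ex[of 1] using ext_refl by blast
    have "forces \<phi> (e(0 := s, 1 := t)) r' \<longleftrightarrow> forces \<phi> (e(0 := e u, 1 := e v)) r'"
      by (rule forces_cong) (use r'(2) u v in \<open>auto simp: forces_And intro: gen_triv\<close>)
    then have "forces \<phi> (e(0 := e u, 1 := e v)) r'" using r'(2) unfolding forces_And by blast
    then show "\<exists>r. r \<sqsubseteq> q \<and> forces \<phi> (e(0 := e u, 1 := e v)) r" using r(1) r'(1) ext_trans by blast
  qed
next
  assume R: "forces \<phi> (e(0 := e u, 1 := e v)) p"
  show "forces (inst \<phi> u v) e p"
    unfolding inst_def
    by (rule forces_ExI[where t = "e u"], rule forces_ExI[where t = "e v"])
       (use R u v in \<open>auto simp: forces_And intro: gen_triv\<close>)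
qed

section \<open>Translations of names\<close>

primrec tn :: "point \<Rightarrow> nm \<Rightarrow> nm" where
  "tn d Emp = Emp"
| "tn d (Nm f S) = Nm (\<lambda>n. tn d (f n)) (\<lambda>n. shiftc d ` S n)"

lemma opn_shift [simp]: "opn (shiftc d ` S) (shift d x) \<longleftrightarrow> opn S x"
  by (auto simp: opn_def meets_shift)

lemma val_tn_shift [simp]: "val (tn d t) (shift d x) = val t x"
  by (induction t) simp_all

lemma val_tn: "val (tn d t) x = val t (shift (- d) x)"
  using val_tn_shift[of d t "shift (- d) x"] by simp

lemma tn_inverse: "tn d (tn (- d) t) = t"
proof (induction t)
  case (Nm f S)
  show ?case
    by (simp only: tn.simps image_image shiftc_inverse image_ident Nm.IH[OF rangeI])
qed simp

text \<open>The symmetry lemma of forcing. The step for \<open>Imp\<close> uses that translation is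
  bijective on conditions, the step for \<open>All\<close> that it is surjective on names.\<close>

lemma forces_tn: "forces \<phi> (\<lambda>v. tn d (e v)) (shiftc d p) \<longleftrightarrow> forces \<phi> e p"
proof (induction \<phi> arbitrary: e p)
  case (Imp \<phi> \<psi>)
  have "(\<forall>q. q \<sqsubseteq> shiftc d p \<longrightarrow> P q) \<longleftrightarrow> (\<forall>q. q \<sqsubseteq> p \<longrightarrow> P (shiftc d q))" for P
  proof (intro iffI allI impI)
    fix q assume "\<forall>q. q \<sqsubseteq> p \<longrightarrow> P (shiftc d q)" "q \<sqsubseteq> shiftc d p"
    moreover have "shiftc (- d) q \<sqsubseteq> p"
      using \<open>q \<sqsubseteq> shiftc d p\<close> ext_shiftc[of "- d" q "shiftc d p"] by simp
    ultimately show "P q" using shiftc_inverse(2)[of d q] by metis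
  qed simp
  from this[of "\<lambda>q. forces \<phi> (\<lambda>v. tn d (e v)) q \<longrightarrow> forces \<psi> (\<lambda>v. tn d (e v)) q"]
  show ?case unfolding forces.simps Imp.IH .
next
  case (All v \<phi>)
  have upd: "(\<lambda>v. tn d (e v))(v := tn d t) = (\<lambda>w. tn d ((e(v := t)) w))" for t
    by auto
  have "forces (All v \<phi>) (\<lambda>v. tn d (e v)) (shiftc d p) \<longleftrightarrow>
    (\<forall>t. forces \<phi> ((\<lambda>v. tn d (e v))(v := tn d t)) (shiftc d p))"
    unfolding forces.simps by (metis tn_inverse)
  also have "\<dots> \<longleftrightarrow> forces (All v \<phi>) e p"
    unfolding upd All.IH forces.simps by (rule refl)
  finally show ?case .
qed (simp_all add: gen_shift_iff)

section \<open>Transitive closures\<close>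

text \<open>Its reflexive transitive closure relates \<open>a\<close> to \<open>b\<close> when
  \<open>a\<close> lies in the transitive closure of \<open>{b}\<close>.\<close>

definition memr :: "(hc \<times> hc) set" where "memr = {(a, b). a \<in> elts b}"

lemma rtrancl_memr_iff: "(a, b) \<in> memr\<^sup>* \<longleftrightarrow> a = b \<or> (\<exists>c\<in>elts b. (a, c) \<in> memr\<^sup>*)"
proof
  assume "(a, b) \<in> memr\<^sup>*"
  then show "a = b \<or> (\<exists>c\<in>elts b. (a, c) \<in> memr\<^sup>*)"
    by (cases rule: rtranclE) (auto simp: memr_def)
next
  assume "a = b \<or> (\<exists>c\<in>elts b. (a, c) \<in> memr\<^sup>*)"
  then show "(a, b) \<in> memr\<^sup>*"
    by (auto simp: memr_def intro: rtrancl_into_rtrancl)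
qed

lemma baire_rtrancl_memr: "baire (\<lambda>x. (val s x, val t x) \<in> memr\<^sup>*)"
proof (induction t)
  case Emp
  have "(val s x, val Emp x) \<in> memr\<^sup>* \<longleftrightarrow> val s x = val Emp x" for x
    by (subst rtrancl_memr_iff) simp
  then show ?case using baire_val_eq by (simp only:)
next
  case (Nm f S)
  have "(val s x, val (Nm f S) x) \<in> memr\<^sup>* \<longleftrightarrow> val s x = val (Nm f S) x \<or>
    (\<exists>n. opn (S n) x \<and> (val s x, val (f n) x) \<in> memr\<^sup>*)" for x
    by (subst rtrancl_memr_iff) auto
  moreover have "baire (\<lambda>x. val s x = val (Nm f S) x \<or>
    (\<exists>n. opn (S n) x \<and> (val s x, val (f n) x) \<in> memr\<^sup>*))"
    by (intro baire_disj baire_ex baire_conj baire_opn baire_val_eq Nm) simp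
  ultimately show ?case by simp
qed

text \<open>Names reached along finite paths of indices. They are countably many, and at every point
  their values cover the transitive closure of the value of \<open>t\<close>; this is the
  countability to which category is applied.\<close>

primrec sub :: "nat list \<Rightarrow> nm \<Rightarrow> nm" where
  "sub [] t = t"
| "sub (n # l) t = nms (sub l t) n"

lemma rtrancl_memr_sub:
  assumes "(a, val t x) \<in> memr\<^sup>*" shows "\<exists>l. a = val (sub l t) x"
  using assms
proof (induction rule: converse_rtrancl_induct)
  case base
  then show ?case by (intro exI[of _ "[]"]) simp
next
  case (step y z)
  then obtain l where "y \<in> elts (val (sub l t) x)" by (auto simp: memr_def)
  then obtain n where "y = val (nms (sub l t) n) x" unfolding mem_val_iff by blast
  then show ?case by (intro exI[of _ "n # l"]) simp
qed

section \<open>Ingredients of the turbulence argument\<close>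

lemma gen_ball:
  assumes "countable A" and "\<And>a. a \<in> A \<Longrightarrow> gen p (X a)"
  shows "gen p (\<lambda>x. \<forall>a\<in>A. X a x)"
proof (cases "A = {}")
  case True
  then show ?thesis by (simp add: gen_triv)
next
  case False
  have "gen p (\<lambda>x. \<forall>n. X (from_nat_into A n) x)"
    by (intro gen_all assms(2) from_nat_into False)
  then show ?thesis
    by (rule gen_imp) (use assms(1) from_nat_into_surj in metis)
qed

lemma ext_exact: "length p \<le> n \<Longrightarrow> \<exists>q. q \<sqsubseteq> p \<and> length q = n"
  by (rule exI[of _ "p @ replicate (n - length p) 0"]) (auto simp: ext_def nth_append)

text \<open>Unit steps, iterated in either direction and made at one coordinate after another,
  connect any two extensions of \<open>r\<close> of equal length.\<close>

lemma invariant_under_unit_steps: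
  fixes G :: "int list \<Rightarrow> bool"
  assumes step: "\<And>s i. length s = N \<Longrightarrow> s \<sqsubseteq> r \<Longrightarrow> length r \<le> i \<Longrightarrow> i < N \<Longrightarrow>
      G (s[i := s ! i + 1]) \<longleftrightarrow> G s"
    and s: "length s = N" "s \<sqsubseteq> r" and s': "length s' = N" "s' \<sqsubseteq> r"
  shows "G s \<longleftrightarrow> G s'"
proof -
  have nat: "G (t[i := t ! i + int n]) \<longleftrightarrow> G t"
    if t: "length t = N" "t \<sqsubseteq> r" "length r \<le> i" "i < N" for t i n
  proof (induction n)
    case (Suc n)
    let ?t = "t[i := t ! i + int n]"
    have "?t \<sqsubseteq> r" using t by (auto simp: ext_def nth_list_update)
    then have "G (?t[i := ?t ! i + 1]) \<longleftrightarrow> G ?t" using t by (intro step) auto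
    then show ?case using Suc t by (simp add: ac_simps)
  qed (use t in simp)
  have int: "G (t[i := m]) \<longleftrightarrow> G t"
    if t: "length t = N" "t \<sqsubseteq> r" "length r \<le> i" "i < N" for t i m
  proof (cases "t ! i \<le> m")
    case True
    then show ?thesis using nat[OF t, of "nat (m - t ! i)"] by simp
  next
    case False
    \<comment> \<open>Descending from \<open>t ! i\<close> to \<open>m\<close> is ascending from
      \<open>m\<close>, read backwards.\<close>
    let ?t = "t[i := m]"
    have "?t \<sqsubseteq> r" using t by (auto simp: ext_def nth_list_update)
    then have "G (?t[i := ?t ! i + int (nat (t ! i - m))]) \<longleftrightarrow> G ?t" using t by (intro nat) auto
    then show ?thesis using False t by simp
  qed
  \<comment> \<open>The path from \<open>s\<close> to \<open>s'\<close> runs through hybrids that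
    already agree with \<open>s'\<close> on the first \<open>j\<close> coordinates.\<close>
  have "G (take j s' @ drop j s) \<longleftrightarrow> G s" if "j \<le> N" for j
    using that
  proof (induction j)
    case (Suc j)
    let ?h = "take j s' @ drop j s"
    have h: "length ?h = N" "?h \<sqsubseteq> r" using Suc.prems s s' by (auto simp: ext_def nth_append)
    have eq: "take (Suc j) s' @ drop (Suc j) s = ?h[j := s' ! j]"
      by (rule nth_equalityI) (use Suc.prems s s' in \<open>auto simp: nth_append nth_list_update min_def less_Suc_eq\<close>)
    have "G (?h[j := s' ! j]) \<longleftrightarrow> G ?h"
    proof (cases "length r \<le> j")
      case True
      then show ?thesis using int[OF h] Suc.prems by simp
    next
      case False
      then have "?h ! j = s' ! j" using Suc.prems s s' by (auto simp: ext_def nth_append)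
      then have "?h[j := s' ! j] = ?h" by (metis list_update_id)
      then show ?thesis by simp
    qed
    then show ?case using Suc unfolding eq by simp
  qed simp
  from this[of N] show ?thesis using s s' by simp
qed

lemma baire_elem: "baire (\<lambda>x. a \<in> elts (val t x))"
  using baire_val_mem[of "check a" t] by simp

lemma shiftc_zero: "(\<And>i. i < length p \<Longrightarrow> d i = 0) \<Longrightarrow> shiftc d p = p"
  by (rule nth_equalityI) simp_all

text \<open>If countably many sets cover the 0-1 sequences vanishing below \<open>n\<close>, one of
  them is dense in a cylinder. The category theorem at hand concerns integer sequences, so it is
  pulled back along \<open>c\<close>, which reduces coordinates modulo 2.\<close>

lemma countable_cover_dense_in_cylinder:
  fixes B :: "'i :: countable \<Rightarrow> point set"
  assumes cover: "\<And>z. range z \<subseteq> {0, 1} \<Longrightarrow> (\<And>i. i < n \<Longrightarrow> z i = 0) \<Longrightarrow> \<exists>i. z \<in> B i"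
  shows "\<exists>i u. range u \<subseteq> {0, 1} \<and> (\<forall>j<n. u j = 0) \<and> (\<exists>k\<ge>n. \<forall>N z. range z \<subseteq> {0, 1} \<longrightarrow> (\<forall>j<k. z j = u j) \<longrightarrow>
      (\<exists>z'\<in>B i. \<forall>j<N. z' j = z j))"
proof -
  define c :: "point \<Rightarrow> point" where "c x = (\<lambda>i. if i < n then 0 else x i mod 2)" for x
  have c: "range (c x) \<subseteq> {0, 1}" "j < n \<Longrightarrow> c x j = 0" for x j
    by (auto simp: c_def)
  \<comment> \<open>Conditions whose whole cylinder is mapped outside \<open>B i\<close>. Were every
    \<open>D i\<close> dense, some point would be mapped outside all the covering sets.\<close>
  define D where "D i = {w. \<forall>x. meets x w \<longrightarrow> c x \<notin> B i}" for i
  have "\<exists>i. \<not> dense (D i)"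
  proof (rule ccontr)
    assume "\<not> ?thesis"
    then have "gen [] (\<lambda>x. \<forall>i. \<exists>r\<in>D i. meets x r)"
      by (intro gen_countableI[where D = D]) auto
    then obtain x where x: "\<forall>i. \<exists>r\<in>D i. meets x r" using gen_ex_point by blast
    obtain i where "c x \<in> B i" using cover[of "c x"] c by blast
    then show False using x unfolding D_def by blast
  qed
  then obtain i w where w: "\<And>w'. w' \<sqsubseteq> w \<Longrightarrow> w' \<notin> D i" unfolding dense_def by blast
  \<comment> \<open>Padding makes \<open>w0\<close> at least \<open>n\<close> long, so that beyond
    it \<open>c\<close> is plain reduction modulo 2.\<close>
  define w0 where "w0 = w @ replicate n 0"
  have w0: "w0 \<sqsubseteq> w" "n \<le> length w0" by (auto simp: w0_def ext_def nth_append)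
  define u where "u = c (\<lambda>j. if j < length w0 then w0 ! j else 0)"
  have "\<exists>z'\<in>B i. \<forall>j<N. z' j = z j"
    if z: "range z \<subseteq> {0, 1}" "\<forall>j<length w0. z j = u j" for N z
  proof -
    define w' where "w' = w0 @ map z [length w0..<N]"
    have "w' \<sqsubseteq> w" using w0 ext_trans[of w' w0 w] by (auto simp: w'_def ext_def nth_append)
    then obtain x where x: "meets x w'" "c x \<in> B i" using w unfolding D_def by blast
    have "c x j = z j" if j: "j < N" for j
    proof (cases "j < length w0")
      case True
      then have "x j = w0 ! j" using x(1) by (auto simp: meets_def w'_def nth_append)
      then show ?thesis using True z(2) by (simp add: u_def c_def)
    next
      case False
      then have "x j = z j" using x(1) j by (auto simp: meets_def w'_def nth_append)
      moreover have "z j = 0 \<or> z j = 1" using z(1) by auto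
      ultimately show ?thesis using False w0(2) by (auto simp: c_def)
    qed
    then show ?thesis using x(2) by blast
  qed
  then show ?thesis
    by (intro exI[of _ i] exI[of _ u] conjI exI[of _ "length w0"]) (use c w0 in \<open>auto simp: u_def\<close>)
qed

text \<open>The value must be the set of those \<open>a\<close> in \<open>A\<close> whose membership
  is forced. Countability of \<open>A\<close> lets all decisions hold at once and makes this set
  hereditarily countable.\<close>

lemma decided_elements_imp_constant:
  assumes sub: "gen q (\<lambda>x. elts (val t x) \<subseteq> A)" and A: "countable A"
    and dec: "\<And>a. a \<in> A \<Longrightarrow> gen q (\<lambda>x. a \<in> elts (val t x)) \<or> gen q (\<lambda>x. a \<notin> elts (val t x))"
  shows "\<exists>a. gen q (\<lambda>x. val t x = a)"
proof -
  let ?B = "{a \<in> A. gen q (\<lambda>x. a \<in> elts (val t x))}"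
  have B: "countable ?B" using A by simp
  have "gen q (\<lambda>x. \<forall>a\<in>A. a \<in> elts (val t x) \<longleftrightarrow> a \<in> ?B)"
  proof (rule gen_ball[OF A])
    fix a assume a: "a \<in> A"
    show "gen q (\<lambda>x. a \<in> elts (val t x) \<longleftrightarrow> a \<in> ?B)"
    proof (cases "gen q (\<lambda>x. a \<in> elts (val t x))")
      case True
      then show ?thesis by (rule gen_imp) (use True a in simp)
    next
      case False
      with dec[OF a] have "gen q (\<lambda>x. a \<notin> elts (val t x))" by blast
      then show ?thesis by (rule gen_imp) (use False in simp)
    qed
  qed
  from gen_conj[OF this sub] have "gen q (\<lambda>x. val t x = mk ?B)"
    by (rule gen_imp) (use B in \<open>auto simp: hc_eq_iff[of _ "mk ?B"]\<close>)
  then show ?thesis ..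
qed

text \<open>The turbulence argument, by induction on the name \<^term>\<open>s\<close>: its candidates already being decided,
\<^term>\<open>s\<close> is in effect a subset of a fixed countable set, and it takes only countably many values under
the translations by 0-1 sequences.\<close>

lemma constant_or_outside:
  assumes inv: "\<And>z. range z \<subseteq> {0, 1} \<Longrightarrow> (\<And>i. i < length p \<Longrightarrow> z i = 0) \<Longrightarrow>
      gen p (\<lambda>x. val t x = val t (shift z x))"
    and "q \<sqsubseteq> p"
  shows "\<exists>r. r \<sqsubseteq> q \<and> (gen r (\<lambda>x. (val s x, val t x) \<notin> memr\<^sup>*) \<or> (\<exists>a. gen r (\<lambda>x. val s x = a)))"
  using assms(2)
proof (induction s arbitrary: q)
  case Emp
  have "gen q (\<lambda>x. val Emp x = mk {})" by (simp add: gen_triv)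
  then show ?case using ext_refl by blast
next
  case (Nm f S)
  let ?s = "Nm f S"
  show ?case
  proof (cases "\<exists>r. r \<sqsubseteq> q \<and> gen r (\<lambda>x. (val ?s x, val t x) \<notin> memr\<^sup>*)")
    case True
    then show ?thesis by blast
  next
    case False
    then have inside: "gen q (\<lambda>x. (val ?s x, val t x) \<in> memr\<^sup>*)"
      using not_genD[OF baire_rtrancl_memr] by blast
    \<comment> \<open>All values that some condition forces on a candidate. A condition forces at
      most one value on each candidate, so \<open>A\<close> is countable.\<close>
    define A where "A = (\<Union>n r. {a. gen r (\<lambda>x. val (f n) x = a)})"
    have "countable {a. gen r (\<lambda>x. val (f n) x = a)}" for n r
    proof -
      have "a = b" if "gen r (\<lambda>x. val (f n) x = a)" "gen r (\<lambda>x. val (f n) x = b)" for a b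
        using gen_ex_point[OF gen_conj[OF that]] by auto
      then have "{a. gen r (\<lambda>x. val (f n) x = a)} \<subseteq> {SOME a. gen r (\<lambda>x. val (f n) x = a)}"
        by (auto intro: someI2)
      then show ?thesis by (rule countable_subset) simp
    qed
    then have A: "countable A" unfolding A_def by (intro countable_UN) auto
    have "gen q (\<lambda>x. opn (S n) x \<longrightarrow> val (f n) x \<in> A)" for n
    proof (rule gen_dense)
      fix q' assume q': "q' \<sqsubseteq> q"
      then have "q' \<sqsubseteq> p" using Nm.prems ext_trans by blast
      from Nm.IH[OF rangeI this, of n] obtain r where r: "r \<sqsubseteq> q'"
        "gen r (\<lambda>x. (val (f n) x, val t x) \<notin> memr\<^sup>*) \<or> (\<exists>a. gen r (\<lambda>x. val (f n) x = a))" by blast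
      from r(2) have "gen r (\<lambda>x. opn (S n) x \<longrightarrow> val (f n) x \<in> A)"
      proof
        \<comment> \<open>A candidate outside the transitive closure of the value of
          \<open>t\<close> cannot be active, because the value of \<open>?s\<close> lies inside
          it.\<close>
        assume out: "gen r (\<lambda>x. (val (f n) x, val t x) \<notin> memr\<^sup>*)"
        have "gen r (\<lambda>x. (val ?s x, val t x) \<in> memr\<^sup>*)"
          using inside r(1) q' ext_trans gen_mono by blast
        with out show ?thesis
        proof (rule gen_imp2)
          fix x assume o: "(val (f n) x, val t x) \<notin> memr\<^sup>*" and i: "(val ?s x, val t x) \<in> memr\<^sup>*"
          have "\<not> opn (S n) x"
          proof
            assume "opn (S n) x"
            then have "(val (f n) x, val ?s x) \<in> memr" by (auto simp: memr_def)
            then show False using i o converse_rtrancl_into_rtrancl by metis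
          qed
          then show "opn (S n) x \<longrightarrow> val (f n) x \<in> A" by simp
        qed
      next
        assume "\<exists>a. gen r (\<lambda>x. val (f n) x = a)"
        then obtain a where a: "gen r (\<lambda>x. val (f n) x = a)" by blast
        then have "a \<in> A" unfolding A_def by blast
        with a show ?thesis by (elim gen_imp) simp
      qed
      then show "\<exists>r. r \<sqsubseteq> q' \<and> gen r (\<lambda>x. opn (S n) x \<longrightarrow> val (f n) x \<in> A)" using r(1) by blast
    qed
    then have "gen q (\<lambda>x. \<forall>n. opn (S n) x \<longrightarrow> val (f n) x \<in> A)" by (rule gen_all)
    then have subA: "gen q (\<lambda>x. elts (val ?s x) \<subseteq> A)"
      by (rule gen_imp) (auto simp: elts_val)
    \<comment> \<open>Translations are sorted by a condition \<open>r\<close> and a path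
      \<open>l\<close> such that \<open>r\<close> forces the translated value of \<open>?s\<close>
      to be that of \<open>sub l t\<close>. Invariance of \<open>t\<close> keeps the translated
      value inside the transitive closure, so every 0-1 translation vanishing on \<open>q\<close> is
      sorted somewhere.\<close>
    define B where "B = (\<lambda>(r, l). {z. r \<sqsubseteq> q \<and> gen r (\<lambda>x. val ?s (shift z x) = val (sub l t) x)})"
    have cover: "\<exists>i. z \<in> B i" if z: "range z \<subseteq> {0, 1}" "\<And>i. i < length q \<Longrightarrow> z i = 0" for z
    proof -
      have "length p \<le> length q" using Nm.prems by (simp add: ext_def)
      then have "gen p (\<lambda>x. val t x = val t (shift z x))" using z by (intro inv) auto
      then have 1: "gen q (\<lambda>x. val t x = val t (shift z x))" using Nm.prems gen_mono by blast
      have "gen (shiftc z q) (\<lambda>x. (val ?s x, val t x) \<in> memr\<^sup>*)"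
        using inside shiftc_zero[of q z] z(2) by simp
      then have 2: "gen q (\<lambda>x. (val ?s (shift z x), val t (shift z x)) \<in> memr\<^sup>*)"
        by (rule gen_shift_iff[THEN iffD1])
      have "gen q (\<lambda>x. \<exists>l. val ?s (shift z x) = val (sub l t) x)"
        using 1 2
      proof (rule gen_imp2)
        fix x assume "val t x = val t (shift z x)" "(val ?s (shift z x), val t (shift z x)) \<in> memr\<^sup>*"
        then have "(val ?s (shift z x), val t x) \<in> memr\<^sup>*" by (simp only:)
        then show "\<exists>l. val ?s (shift z x) = val (sub l t) x" by (rule rtrancl_memr_sub)
      qed
      moreover have "baire (\<lambda>x. val ?s (shift z x) = val (sub l t) x)" for l
        using baire_val_eq[of "tn (- z) ?s" "sub l t"] unfolding val_tn by simp
      ultimately obtain r l where "r \<sqsubseteq> q" "gen r (\<lambda>x. val ?s (shift z x) = val (sub l t) x)"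
        using gen_exD[of "\<lambda>l x. val ?s (shift z x) = val (sub l t) x" q] by blast
      then have "z \<in> B (r, l)" by (simp add: B_def)
      then show ?thesis ..
    qed
    obtain r l u k where u: "range u \<subseteq> {0, 1}" "\<forall>j<length q. u j = 0" and k: "k \<ge> length q"
      and dns: "\<And>N z. range z \<subseteq> {0, 1} \<Longrightarrow> (\<forall>j<k. z j = u j) \<Longrightarrow> \<exists>z'\<in>B (r, l). \<forall>j<N. z' j = z j"
      using countable_cover_dense_in_cylinder[of "length q" B, OF cover] by (auto simp: split_paired_Ex)
    obtain k' where k': "k \<le> k'" "length r \<le> k'" using nat_le_linear by blast
    obtain r1 where r1: "r1 \<sqsubseteq> r" "length r1 = k'" using ext_exact k'(2) by blast
    \<comment> \<open>Vanishing beyond \<open>k'\<close>, \<open>u'\<close> leaves room to raise a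
      later coordinate from 0 to 1 within the 0-1 sequences.\<close>
    define u' where "u' j = (if j < k' then u j else 0)" for j
    have u': "range u' \<subseteq> {0, 1}" "\<forall>j<k. u' j = u j" using u(1) k' by (auto simp: u'_def)
    \<comment> \<open>Density, even with \<open>N = 0\<close>, yields a member of
      \<open>B (r, l)\<close>, and membership there includes
      \<open>r \<sqsubseteq> q\<close>.\<close>
    have rq: "r \<sqsubseteq> q" using dns[OF u', of 0] by (auto simp: B_def)
    define r2 where "r2 = shiftc u' r1"
    have len2: "length r2 = k'" by (simp add: r2_def r1)
    have "shiftc u' q = q" using u(2) k k' by (intro shiftc_zero) (simp add: u'_def)
    then have r2q: "r2 \<sqsubseteq> q"
      using ext_shiftc[of u' r1 q] ext_trans[OF r1(1) rq] unfolding r2_def by simp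
    have approx: "\<exists>z'. (\<forall>j<N. z' j = z j) \<and> gen r1 (\<lambda>x. val ?s (shift z' x) = val (sub l t) x)"
      if "range z \<subseteq> {0, 1}" "\<forall>j<k'. z j = u' j" for z N
    proof -
      have "\<forall>j<k. z j = u j" using that(2) u'(2) k'(1) by auto
      from dns[OF that(1) this, of N] obtain z' where "z' \<in> B (r, l)" "\<forall>j<N. z' j = z j" by blast
      then show ?thesis using gen_mono[OF _ r1(1)] by (auto simp: B_def)
    qed
    have step: "gen (s[i := s ! i + 1]) (\<lambda>x. a \<in> elts (val ?s x)) \<longleftrightarrow> gen s (\<lambda>x. a \<in> elts (val ?s x))"
      if s: "length s = N" "s \<sqsubseteq> r2" "length r2 \<le> i" "i < N" for s N i a
    proof -
      have "u' i = 0" using s(3) len2 by (simp add: u'_def)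
      obtain z1 where z1: "\<forall>j<N. z1 j = u' j" "gen r1 (\<lambda>x. val ?s (shift z1 x) = val (sub l t) x)"
        using approx[OF u'(1)] by blast
      have "range (u'(i := 1)) \<subseteq> {0, 1}" "\<forall>j<k'. (u'(i := 1)) j = u' j"
        using u'(1) s(3) len2 by auto
      from approx[OF this] obtain z2 where z2: "\<forall>j<N. z2 j = (u'(i := 1)) j"
        "gen r1 (\<lambda>x. val ?s (shift z2 x) = val (sub l t) x)"
        by blast
      \<comment> \<open>Both translations carry the value of \<open>?s\<close> to that of the same
        name \<open>sub l t\<close>, so \<open>d\<close> fixes it below \<open>r2\<close>. On the
        first \<open>N\<close> coordinates \<open>d\<close> is the unit vector at \<open>i\<close>;
        its later coordinates do not affect a condition of length \<open>N\<close>.\<close>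
      define d where "d j = z2 j - z1 j" for j
      have sh: "shift z2 x = shift d (shift z1 x)" for x by (simp add: shift_def d_def)
      have kN: "k' \<le> N" using s(3,4) len2 by simp
      have "gen r1 (\<lambda>x. val ?s (shift z1 x) = val ?s (shift d (shift z1 x)))"
        using z1(2) z2(2) by (rule gen_imp2) (simp add: sh)
      then have "gen (shiftc z1 r1) (\<lambda>x. val ?s x = val ?s (shift d x))"
        by (rule gen_shift_iff[THEN iffD2])
      moreover have "shiftc z1 r1 = r2"
        unfolding r2_def by (rule nth_equalityI) (use z1(1) kN r1(2) in auto)
      ultimately have "gen s (\<lambda>x. val ?s x = val ?s (shift d x))" using s(2) gen_mono by simp
      then have "gen s (\<lambda>x. a \<in> elts (val ?s (shift d x)) \<longleftrightarrow> a \<in> elts (val ?s x))"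
        by (rule gen_imp) simp
      then have "gen (shiftc d s) (\<lambda>x. a \<in> elts (val ?s x)) \<longleftrightarrow> gen s (\<lambda>x. a \<in> elts (val ?s x))"
        unfolding gen_shift_iff by (rule gen_cong)
      moreover have "shiftc d s = s[i := s ! i + 1]"
        by (rule nth_equalityI) (use z1(1) z2(1) \<open>u' i = 0\<close> s in \<open>auto simp: d_def nth_list_update\<close>)
      ultimately show ?thesis by (simp only:)
    qed
    have "gen r2 (\<lambda>x. a \<in> elts (val ?s x)) \<or> gen r2 (\<lambda>x. a \<notin> elts (val ?s x))" for a
    proof (rule ccontr)
      assume n: "\<not> ?thesis"
      obtain s1 where s1: "s1 \<sqsubseteq> r2" "gen s1 (\<lambda>x. a \<notin> elts (val ?s x))"
        using not_genD[OF baire_elem] n by blast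
      obtain s0 where s0: "s0 \<sqsubseteq> r2" "gen s0 (\<lambda>x. a \<in> elts (val ?s x))"
        using not_genD[OF baire_not[OF baire_elem]] n unfolding not_not by blast
      define N where "N = max (length s0) (length s1)"
      obtain t0 t1 where t: "t0 \<sqsubseteq> s0" "length t0 = N" "t1 \<sqsubseteq> s1" "length t1 = N"
        using ext_exact[of s0 N] ext_exact[of s1 N] by (auto simp: N_def)
      have "gen t0 (\<lambda>x. a \<in> elts (val ?s x)) \<longleftrightarrow> gen t1 (\<lambda>x. a \<in> elts (val ?s x))"
        by (rule invariant_under_unit_steps[where r = r2 and N = N])
           (use step t s0(1) s1(1) ext_trans in blast)+
      then have "gen t1 (\<lambda>x. a \<in> elts (val ?s x))" using gen_mono[OF s0(2) t(1)] by simp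
      from gen_ex_point[OF gen_conj[OF this gen_mono[OF s1(2) t(3)]]] show False by blast
    qed
    then have "\<exists>a. gen r2 (\<lambda>x. val ?s x = a)"
      by (intro decided_elements_imp_constant[OF gen_mono[OF subA r2q] A])
    then show ?thesis using r2q by blast
  qed
qed

section \<open>Hypographs of integer sequences\<close>

text \<open>A natural number stands for a pair of an argument and an integer, so that the hypographs
  \<open>H_k\<close> become sets of numerals and every candidate of their names is a ground
  set.\<close>

definition row :: "nat \<Rightarrow> nat" where "row m = fst (from_nat m :: nat \<times> int)"
definition col :: "nat \<Rightarrow> int" where "col m = snd (from_nat m :: nat \<times> int)"

definition hypo :: "nat \<Rightarrow> point \<Rightarrow> hc" where
  "hypo k x = mk {num m |m. col m \<le> x (row m) + int k}"

definition hypo_nm :: "nat \<Rightarrow> nm" where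
  "hypo_nm k = Nm (\<lambda>m. check (num m))
    (\<lambda>m. {p. row m < length p \<and> col m \<le> p ! row m + int k})"

definition hypos :: "point \<Rightarrow> hc" where "hypos x = mk (range (\<lambda>k. hypo k x))"

definition hypos_nm :: nm where "hypos_nm = Nm hypo_nm (\<lambda>k. UNIV)"

lemma elts_hypo: "elts (hypo k x) = {num m |m. col m \<le> x (row m) + int k}"
proof -
  have "countable {num m |m. col m \<le> x (row m) + int k}"
    by (rule countable_subset[of _ "range num"]) auto
  then show ?thesis by (simp add: hypo_def)
qed

lemma val_hypo_nm [simp]: "val (hypo_nm k) x = hypo k x"
proof -
  have "opn {p. n < length p \<and> j \<le> p ! n + int k} x \<longleftrightarrow> j \<le> x n + int k" for n j
  proof
    assume "j \<le> x n + int k"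
    then show "opn {p. n < length p \<and> j \<le> p ! n + int k} x"
      unfolding opn_def by (intro bexI[of _ "map x [0..<Suc n]"]) (auto simp: meets_def simp del: upt_Suc)
  qed (auto simp: opn_def meets_def)
  then have "elts (val (hypo_nm k) x) = elts (hypo k x)"
    unfolding elts_val elts_hypo by (simp add: hypo_nm_def)
  then show ?thesis by (simp only: hc_eq_iff)
qed

lemma val_hypos_nm [simp]: "val hypos_nm x = hypos x"
  by (simp add: hypos_nm_def hypos_def)

lemma elts_hypos: "elts (hypos x) = range (\<lambda>k. hypo k x)"
  by (simp add: hypos_def)

lemma hypo_mono: "(\<And>n. x n + int k \<le> y n + int l) \<Longrightarrow> elts (hypo k x) \<subseteq> elts (hypo l y)"
proof -
  assume le: "\<And>n. x n + int k \<le> y n + int l"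
  show ?thesis unfolding elts_hypo using order_trans[OF _ le] by blast
qed

text \<open>A change by at most 1 is absorbed by passing from \<open>k\<close> to
  \<open>Suc k\<close>.\<close>

lemma samedown_hypos:
  assumes "\<And>n. \<bar>x n - y n\<bar> \<le> 1" shows "samedown (hypos x) (hypos y)"
proof -
  have "elts (hypo k x) \<subseteq> elts (hypo (Suc k) y)" "elts (hypo k y) \<subseteq> elts (hypo (Suc k) x)" for k
    using assms by (auto intro!: hypo_mono simp: abs_le_iff algebra_simps)
  then show ?thesis unfolding samedown_def elts_hypos by blast
qed

text \<open>One member \<open>hypo k y\<close> must contain all of \<open>hypo 0 x\<close>, in
  particular the graph of \<open>x\<close>; its \<open>k\<close> bounds every coordinate at
  once.\<close>

lemma samedown_hypos_bounded:
  assumes "samedown (hypos x) (hypos y)" shows "\<exists>k. \<forall>n. x n \<le> y n + int k"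
proof -
  have "\<exists>w\<in>elts (hypos x). elts (hypo 0 x) \<subseteq> elts w" unfolding elts_hypos by blast
  then obtain k where k: "elts (hypo 0 x) \<subseteq> elts (hypo k y)"
    using assms unfolding samedown_def elts_hypos by blast
  have "x n \<le> y n + int k" for n
  proof -
    let ?m = "to_nat (n, x n)"
    have m: "row ?m = n" "col ?m = x n" by (simp_all add: row_def col_def)
    have "num ?m \<in> elts (hypo 0 x)" unfolding elts_hypo using m by force
    then have "num ?m \<in> elts (hypo k y)" using k by blast
    then show ?thesis using m by (auto simp: elts_hypo)
  qed
  then show ?thesis by blast
qed

theorem theorem3p2:
  shows "\<not> eliminates_imaginaries ZFC_minus_count"
proof
  assume "eliminates_imaginaries ZFC_minus_count"
  moreover have "FV cofin01 \<subseteq> {0, 1}" by simp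
  ultimately obtain F where FV: "FV F \<subseteq> {0, 1}" and fn: "proves_function ZFC_minus_count F"
    and red: "proves_reduces ZFC_minus_count cofin01 F"
    using proves_equiv_rel_cofin unfolding eliminates_imaginaries_def by blast
  \<comment> \<open>\<open>\<Phi> s t p\<close> means that \<open>p\<close> forces \<open>F\<close>
    to take \<open>s\<close> to \<open>t\<close>; as \<open>F\<close> has no further free variables,
    the rest of the assignment is filled with \<open>Emp\<close>.\<close>
  define \<Phi> where "\<Phi> s t p \<longleftrightarrow> forces F ((\<lambda>_. Emp)(0 := s, 1 := t)) p" for s t p
  have inst: "forces (inst F u v) e p \<longleftrightarrow> \<Phi> (e u) (e v) p" if "u \<notin> {0, 1}" "v \<notin> {0, 1}" for u v e p
    unfolding forces_inst[OF that] \<Phi>_def by (rule forces_agree) (use FV in auto)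
  have \<Phi>_mono: "\<Phi> s t p \<Longrightarrow> q \<sqsubseteq> p \<Longrightarrow> \<Phi> s t q" for s t p q
    unfolding \<Phi>_def by (rule forces_mono)
  have \<Phi>_cong: "\<Phi> s t p \<longleftrightarrow> \<Phi> s t' p" if "gen p (\<lambda>x. val t x = val t' x)" for s t t' p
    unfolding \<Phi>_def by (rule forces_cong) (use that in \<open>auto intro: gen_triv\<close>)
  have \<Phi>_tn: "\<Phi> (tn d s) (tn d t) p" if "\<Phi> s t p" "shiftc d p = p" for d s t p
  proof -
    have eq: "(\<lambda>v. tn d (((\<lambda>_. Emp)(0 := s, 1 := t)) v)) = (\<lambda>_. Emp)(0 := tn d s, 1 := tn d t)"
      by auto
    have "forces F (\<lambda>v. tn d (((\<lambda>_. Emp)(0 := s, 1 := t)) v)) (shiftc d p)"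
      using that(1) unfolding \<Phi>_def by (rule forces_tn[THEN iffD2])
    then show ?thesis
      unfolding \<Phi>_def that(2) by (rule subst[OF eq, of "\<lambda>e. forces F e p"])
  qed
  have fn': "\<exists>r t. r \<sqsubseteq> q \<and> \<Phi> s t r \<and> (\<forall>t' q'. q' \<sqsubseteq> r \<longrightarrow> \<Phi> s t' q' \<longrightarrow> gen q' (\<lambda>x. val t' x = val t x))" for s q
  proof -
    have "forces (All 2 (Ex 3 (And (inst F 2 3) (All 4 (Imp (inst F 2 4) (Eq 4 3)))))) (\<lambda>_. Emp) q"
      using forces_sound[OF _ forces_ZFC_minus_count] fn unfolding proves_function_def by blast
    then have "forces (Ex 3 (And (inst F 2 3) (All 4 (Imp (inst F 2 4) (Eq 4 3))))) ((\<lambda>_. Emp)(2 := s)) q"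
      unfolding forces.simps(5) by blast
    then obtain r t where r: "r \<sqsubseteq> q"
      "forces (And (inst F 2 3) (All 4 (Imp (inst F 2 4) (Eq 4 3)))) ((\<lambda>_. Emp)(2 := s, 3 := t)) r"
      unfolding forces_Ex using ext_refl by blast
    then have "\<Phi> s t r" "\<And>t' q'. q' \<sqsubseteq> r \<Longrightarrow> \<Phi> s t' q' \<Longrightarrow> gen q' (\<lambda>x. val t' x = val t x)"
      by (auto simp: forces_And inst)
    then show ?thesis using r(1) by blast
  qed
  have uniq: "gen p (\<lambda>x. val t x = val t' x)" if t: "\<Phi> s t p" "\<Phi> s t' p" for s t t' p
  proof (rule gen_dense)
    fix q assume q: "q \<sqsubseteq> p"
    obtain r u where r: "r \<sqsubseteq> q" "\<forall>t' q'. q' \<sqsubseteq> r \<longrightarrow> \<Phi> s t' q' \<longrightarrow> gen q' (\<lambda>x. val t' x = val u x)"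
      using fn'[of q s] by blast
    have "r \<sqsubseteq> p" using r(1) q by (rule ext_trans)
    then have "gen r (\<lambda>x. val t x = val u x)" "gen r (\<lambda>x. val t' x = val u x)"
      using r(2) t \<Phi>_mono ext_refl by blast+
    then have "gen r (\<lambda>x. val t x = val t' x)" by (rule gen_imp2) simp
    then show "\<exists>r. r \<sqsubseteq> q \<and> gen r (\<lambda>x. val t x = val t' x)" using r(1) by blast
  qed
  have red': "gen p (\<lambda>x. samedown (val s x) (val s' x)) \<longleftrightarrow>
      (\<forall>q. q \<sqsubseteq> p \<longrightarrow> (\<exists>r t. r \<sqsubseteq> q \<and> \<Phi> s t r \<and> \<Phi> s' t r))" for s s' p
  proof -
    let ?e = "(\<lambda>_. Emp)(2 := s, 3 := s')"
    have "forces (All 2 (All 3 (Iff (inst cofin01 2 3) (Ex 4 (And (inst F 2 4) (inst F 3 4)))))) (\<lambda>_. Emp) p"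
      using forces_sound[OF _ forces_ZFC_minus_count] red unfolding proves_reduces_def by blast
    then have "forces (Iff (inst cofin01 2 3) (Ex 4 (And (inst F 2 4) (inst F 3 4)))) ?e p"
      unfolding forces.simps(5) by blast
    then have "forces (inst cofin01 2 3) ?e p \<longleftrightarrow> forces (Ex 4 (And (inst F 2 4) (inst F 3 4))) ?e p"
      unfolding forces_Iff using ext_refl by blast
    moreover have "forces (inst cofin01 2 3) ?e p \<longleftrightarrow> gen p (\<lambda>x. samedown (val s x) (val s' x))"
      using pw_cofin[of 0 1] by (simp add: forces_inst pw_def sat_cofin)
    moreover have "forces (Ex 4 (And (inst F 2 4) (inst F 3 4))) ?e p \<longleftrightarrow>
      (\<forall>q. q \<sqsubseteq> p \<longrightarrow> (\<exists>r t. r \<sqsubseteq> q \<and> \<Phi> s t r \<and> \<Phi> s' t r))"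
      unfolding forces_Ex forces_And by (simp add: inst)
    ultimately show ?thesis by blast
  qed
  obtain p t where t: "\<Phi> hypos_nm t p" using fn'[of "[]" hypos_nm] by blast
  \<comment> \<open>Both \<open>t\<close> and its translate are values of \<open>F\<close> at the
    translated \<open>hypos_nm\<close>: \<open>t\<close> because the two arguments are equivalent,
    the translate by symmetry, as \<open>z\<close> vanishes on \<open>p\<close>. Uniqueness
    identifies them.\<close>
  have inv: "gen p (\<lambda>x. val t x = val t (shift z x))"
    if z: "range z \<subseteq> {0, 1}" "\<And>i. i < length p \<Longrightarrow> z i = 0" for z
  proof (rule gen_dense)
    fix q assume q: "q \<sqsubseteq> p"
    let ?s = "tn (- z) hypos_nm"
    have "\<bar>x i - shift z x i\<bar> \<le> 1" for x i
    proof -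
      have "z i \<in> {0, 1}" using z(1) by blast
      then show ?thesis by (auto simp: shift_def)
    qed
    then have "gen p (\<lambda>x. samedown (val hypos_nm x) (val ?s x))"
      by (intro gen_triv) (simp add: val_tn samedown_hypos)
    then obtain r u where r: "r \<sqsubseteq> q" "\<Phi> hypos_nm u r" "\<Phi> ?s u r" unfolding red' using q by blast
    have rp: "r \<sqsubseteq> p" using r(1) q by (rule ext_trans)
    have "gen r (\<lambda>x. val u x = val t x)" by (rule uniq[OF r(2) \<Phi>_mono[OF t rp]])
    then have 1: "\<Phi> ?s t r" using r(3) \<Phi>_cong by blast
    have "\<Phi> ?s (tn (- z) t) p" by (rule \<Phi>_tn[OF t shiftc_zero]) (simp add: z(2))
    then have "\<Phi> ?s (tn (- z) t) r" using rp by (rule \<Phi>_mono)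
    from uniq[OF 1 this] have "gen r (\<lambda>x. val t x = val t (shift z x))" by (simp add: val_tn)
    then show "\<exists>r. r \<sqsubseteq> q \<and> gen r (\<lambda>x. val t x = val t (shift z x))" using r(1) by blast
  qed
  obtain r where r: "r \<sqsubseteq> p"
    "gen r (\<lambda>x. (val t x, val t x) \<notin> memr\<^sup>*) \<or> (\<exists>a. gen r (\<lambda>x. val t x = a))"
    \<comment> \<open>Applied to \<open>t\<close> itself the first alternative is void by
      reflexivity, so \<open>t\<close> has a constant value below some condition.\<close>
    using constant_or_outside[of p t p t, OF inv ext_refl] by blast
  then obtain a where a: "gen r (\<lambda>x. val t x = a)" using not_gen_False by auto
  \<comment> \<open>Zero on \<open>r\<close>, so that the condition is fixed, and unbounded beyond
    it.\<close>
  define d :: point where "d n = (if n < length r then 0 else int n)" for n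
  have d: "shiftc d r = r" by (rule shiftc_zero) (simp add: d_def)
  let ?s = "tn d hypos_nm"
  have t_r: "\<Phi> hypos_nm t r" using t r(1) by (rule \<Phi>_mono)
  have "gen r (\<lambda>x. val (tn d t) x = a)"
    using gen_shift_iff[of d r "\<lambda>x. val (tn d t) x = a"] a by (simp add: d)
  then have "gen r (\<lambda>x. val t x = val (tn d t) x)" by (rule gen_imp2[OF a]) simp
  then have "\<Phi> ?s t r" using \<Phi>_tn[OF t_r d] \<Phi>_cong by blast
  then have "gen r (\<lambda>x. samedown (val hypos_nm x) (val ?s x))"
    unfolding red' using t_r \<Phi>_mono ext_refl by blast
  then obtain x where "samedown (hypos x) (hypos (shift (- d) x))"
    using gen_ex_point by (fastforce simp: val_tn)
  then obtain k where k: "\<And>n. x n \<le> shift (- d) x n + int k" using samedown_hypos_bounded by blast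
  show False
    \<comment> \<open>The index lies beyond \<open>r\<close> and exceeds \<open>k\<close>, so the
      shift there is already larger than \<open>k\<close>.\<close>
    using k[of "length r + Suc k"] by (simp add: shift_def d_def)
qed

end
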